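(* Let $P \subseteq \mathbb{R}^d$ be a $d$-dimensional isotropic simplicial polytope that is a local extremum of the functional $K \mapsto L_K$ (in the space of all $d$-dimensional convex bodies with the Hausdorff topology). Let $H$ be any hyperplane spanned by a $(d-2)$-dimensional face of $P$ and the origin. Then $P$ is symmetric around $H$, i.e. the orthogonal reflection across $H$ maps $P$ to itself. In particular, $P$ is isohedral and all facets of $P$ are congruent.
   Context: A $d$-dimensional convex body is a compact convex set in $\mathbb{R}^d$ with non-empty interior. For a $d$-dimensional convex body $K$ and $X$ uniformly distributed in $K$, let $\mu_K = \mathbb{E}(X)$ and $A(K) = \mathbb{E}\bigl((X-\mu_K)(X-\mu_K)^T\bigr)$ (the covariance matrix). The isotropic constant $L_K > 0$ is defined by $L_K^{2d} = \det(A(K))/(\mathrm{vol}(K))^2$. $K$ is isotropic iff $\mu_K = 0$ and $A(K) = I$. A polytope is the convex hull of finitely many points; it is simplicial if every facet is a simplex. A $d$-dimensional convex body is a local extremum of a functional iff it is a local maximum or a local minimum of the functional in the space of all $d$-dimensional convex bodies with respect to the Hausdorff topology. The full symmetry group of a polytope is the group (under composition) of all isometries of $\mathbb{R}^d$ mapping the polytope to itself. A $d$-dimensional polytope is isohedral iff for any pair of facets $F_1, F_2$ there is an element of its full symmetry group that maps $F_1$ to $F_2$. *)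

theory Defs
  imports "HOL-Analysis.Analysis"
begin

definition convex_body :: "'a::euclidean_space set \<Rightarrow> bool" where
  "convex_body K \<longleftrightarrow> compact K \<and> convex K \<and> interior K \<noteq> {}"

definition centroid :: "(real^'n) set \<Rightarrow> real^'n" where
  "centroid K = (LINT x|uniform_measure lborel K. x)"

definition covariance_matrix :: "(real^'n) set \<Rightarrow> real^'n^'n" where
  "covariance_matrix K =
     (\<chi> i j. LINT x|uniform_measure lborel K. (x - centroid K) $ i * (x - centroid K) $ j)"

text \<open>For a convex body the radicand is positive, so this is the unique positive solution \<open>L\<close> of
  \<open>L ^ (2 * d) = det (covariance_matrix K) / vol(K)\<^sup>2\<close>, where \<open>d = CARD('n)\<close>.\<close>

definition isotropic_constant :: "(real^'n) set \<Rightarrow> real" where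
  "isotropic_constant K =
     root (2 * CARD('n)) (det (covariance_matrix K) / (measure lborel K)\<^sup>2)"

definition isotropic :: "(real^'n) set \<Rightarrow> bool" where
  "isotropic K \<longleftrightarrow> centroid K = 0 \<and> covariance_matrix K = mat 1"

text \<open>Only meaningful for nonempty bounded sets, where the suprema are over bounded nonempty sets.\<close>

definition hausdorff_dist :: "'a::metric_space set \<Rightarrow> 'a set \<Rightarrow> real" where
  "hausdorff_dist A B = max (SUP x\<in>A. infdist x B) (SUP y\<in>B. infdist y A)"

definition local_maximum :: "('a::euclidean_space set \<Rightarrow> real) \<Rightarrow> 'a set \<Rightarrow> bool" where
  "local_maximum f K \<longleftrightarrow> convex_body K \<and>
     (\<exists>e>0. \<forall>L. convex_body L \<and> hausdorff_dist K L < e \<longrightarrow> f L \<le> f K)"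

definition local_minimum :: "('a::euclidean_space set \<Rightarrow> real) \<Rightarrow> 'a set \<Rightarrow> bool" where
  "local_minimum f K \<longleftrightarrow> convex_body K \<and>
     (\<exists>e>0. \<forall>L. convex_body L \<and> hausdorff_dist K L < e \<longrightarrow> f K \<le> f L)"

definition local_extremum :: "('a::euclidean_space set \<Rightarrow> real) \<Rightarrow> 'a set \<Rightarrow> bool" where
  "local_extremum f K \<longleftrightarrow> local_maximum f K \<or> local_minimum f K"

definition simplicial :: "'a::euclidean_space set \<Rightarrow> bool" where
  "simplicial P \<longleftrightarrow> (\<forall>F. F facet_of P \<longrightarrow> (\<exists>n. n simplex F))"

text \<open>For a (closed, nonempty) affine subspace \<open>H\<close>, \<open>closest_point H\<close> is the orthogonal projection
  onto \<open>H\<close>, so this is the orthogonal reflection fixing \<open>H\<close> pointwise.\<close>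

definition reflection_across :: "'a::euclidean_space set \<Rightarrow> 'a \<Rightarrow> 'a" where
  "reflection_across H x = 2 *\<^sub>R closest_point H x - x"

definition isometry :: "('a::metric_space \<Rightarrow> 'a) \<Rightarrow> bool" where
  "isometry g \<longleftrightarrow> surj g \<and> (\<forall>x y. dist (g x) (g y) = dist x y)"

definition symmetry_group :: "'a::euclidean_space set \<Rightarrow> ('a \<Rightarrow> 'a) set" where
  "symmetry_group P = {g. isometry g \<and> g ` P = P}"

definition isohedral :: "'a::euclidean_space set \<Rightarrow> bool" where
  "isohedral P \<longleftrightarrow>
     (\<forall>F G. F facet_of P \<and> G facet_of P \<longrightarrow> (\<exists>g\<in>symmetry_group P. g ` F = G))"

definition congruent_sets :: "'a::metric_space set \<Rightarrow> 'a set \<Rightarrow> bool" where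
  "congruent_sets S T \<longleftrightarrow> (\<exists>g. isometry g \<and> g ` S = T)"

end

theory Submission
  imports Defs
begin

text \<open>Write \<open>d = CARD('n)\<close>. Adding to an isotropic body \<open>P\<close> of volume \<open>V\<close> a simplex \<open>T\<close> of small volume \<open>e\<close>
  changes \<open>log (L\<^sup>2\<^sup>d)\<close> to first order by \<open>(e / V) * (E - (d + 2))\<close>, where \<open>E\<close> is the mean of \<open>\<bar>x\<bar>\<^sup>2\<close> over \<open>T\<close>,
  an explicit quadratic polynomial in the vertices of \<open>T\<close>. If \<open>P\<close> is a local extremum and \<open>T\<close> is a flat tent
  over a facet \<open>F\<close>, with apex just above a point \<open>q\<close> of \<open>F\<close>, this gives an inequality for every \<open>q\<close>. Letting
  \<open>q\<close> tend to the vertices of \<open>F\<close> and summing, one bounds the mean of \<open>\<bar>x\<bar>\<^sup>2\<close> over the cone from the origin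
  over \<open>F\<close> by \<open>d\<close>; since the mean over all of \<open>P\<close> is exactly \<open>d\<close>, equality holds throughout (so no inward
  perturbation is needed), that is, \<open>\<bar>u\<bar>\<^sup>2 + u \<bullet> S = (d + 1) (d + 2)\<close> for every vertex \<open>u\<close> of every facet,
  \<open>S\<close> being the sum of the vertices of that facet. Comparing the equations of two adjacent facets,
  with vertices \<open>B \<union> {w}\<close> and \<open>B \<union> {w'}\<close>, gives \<open>w - w' \<bottom> B\<close> and \<open>\<bar>w\<bar> = \<bar>w'\<bar>\<close>: they are mirror images in the
  hyperplane spanned by \<open>B\<close>. As the facet graph is connected, one facet determines the whole polytope
  by successive reflections, so each of these reflections is a symmetry.\<close>

section \<open>Linear images of Lebesgue measure\<close>

lemma nn_integral_lborel_reflect: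
  fixes t :: "'a::euclidean_space"
  assumes [measurable]: "f \<in> borel_measurable borel"
  shows "(\<integral>\<^sup>+x. f (t - x) \<partial>lborel) = (\<integral>\<^sup>+x. f x \<partial>lborel)"
  by (subst (2) lborel_affine[of "-1" t]) (simp_all add: nn_integral_density nn_integral_distr)

lemma nn_integral_lborel_translate:
  fixes t :: "'a::euclidean_space"
  assumes [measurable]: "f \<in> borel_measurable borel"
  shows "(\<integral>\<^sup>+x. f (x - t) \<partial>lborel) = (\<integral>\<^sup>+x. f x \<partial>lborel)"
  by (subst (2) lborel_affine[of "1" "-t"]) (simp_all add: nn_integral_density nn_integral_distr)

text \<open>Evaluating \<open>\<integral>\<integral> 1\<^sub>A(x) 1\<^sub>B(g z - x) dx dz\<close> in both orders shows that the image of Lebesgue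
  measure under \<open>g\<close> is proportional to Lebesgue measure. (The library's change of variables needs
  a well-ordered index type.)\<close>

lemma lborel_distr_linear:
  fixes g :: "'a::euclidean_space \<Rightarrow> 'a"
  assumes "linear g" "inj g"
  obtains c where "c > 0" "distr lborel borel g = density lborel (\<lambda>_. ennreal c)"
proof -
  obtain h where h: "linear h" "h \<circ> g = id" "g \<circ> h = id"
    using linear_injective_isomorphism[OF assms] by (auto simp: fun_eq_iff)
  have gh: "g (h x) = x" "h (g x) = x" for x using h by (auto simp: fun_eq_iff)
  have cont: "continuous_on S g" "continuous_on S h" for S
    using assms(1) h(1) by (auto intro: linear_continuous_on linear_conv_bounded_linear[THEN iffD1])
  have [measurable]: "g \<in> borel_measurable borel"
    using cont(1) by (rule borel_measurable_continuous_onI)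
  let ?nu = "distr lborel borel g"
  \<comment> \<open>The image measure is translation invariant: a shift by \<open>x\<close> after
    \<open>g\<close> is a shift by \<open>h x\<close> before it, which Lebesgue measure
    ignores.\<close>
  have nu: "(\<integral>\<^sup>+z. indicator B (g z - x) \<partial>lborel) = emeasure ?nu B"
    if [measurable]: "B \<in> sets borel" for B x
  proof -
    have "(\<integral>\<^sup>+z. indicator B (g z - x) \<partial>lborel) = (\<integral>\<^sup>+z. indicator B (g (z - h x)) \<partial>lborel)"
      using assms(1) by (simp add: linear_diff gh)
    also have "\<dots> = (\<integral>\<^sup>+z. indicator B (g z) \<partial>lborel)"
      by (rule nn_integral_lborel_translate[of "\<lambda>z. indicator B (g z)"]) measurable
    also have "\<dots> = (\<integral>\<^sup>+z. indicator B z \<partial>?nu)"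
      by (subst nn_integral_distr) auto
    finally show ?thesis by simp
  qed
  have proportional: "emeasure lborel A * emeasure ?nu B = emeasure lborel B * emeasure ?nu A"
    if [measurable]: "A \<in> sets borel" "B \<in> sets borel" for A B
  proof -
    have I: "pair_sigma_finite lborel (lborel :: 'a measure)"
      by (simp add: lborel_pair.pair_sigma_finite_axioms)
    have eq: "(\<integral>\<^sup>+x. \<integral>\<^sup>+z. indicator A x * indicator B (g z - x) \<partial>lborel \<partial>lborel)
        = emeasure lborel A * emeasure ?nu B"
      if [measurable]: "A \<in> sets borel" "B \<in> sets borel" for A B
      by (simp add: nn_integral_cmult nu nn_integral_multc)
    have "(\<integral>\<^sup>+x. \<integral>\<^sup>+z. indicator A x * indicator B (g z - x) \<partial>lborel \<partial>lborel)
       = (\<integral>\<^sup>+z. \<integral>\<^sup>+x. indicator A x * indicator B (g z - x) \<partial>lborel \<partial>lborel)"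
      by (rule pair_sigma_finite.Fubini'[OF I, symmetric]) measurable
    also have "\<dots> = (\<integral>\<^sup>+z. \<integral>\<^sup>+x. indicator A (g z - x) * indicator B x \<partial>lborel \<partial>lborel)"
    proof (rule nn_integral_cong)
      fix z
      show "(\<integral>\<^sup>+x. indicator A x * indicator B (g z - x) \<partial>lborel)
          = (\<integral>\<^sup>+x. indicator A (g z - x) * indicator B x \<partial>lborel)"
        using nn_integral_lborel_reflect[of "\<lambda>x. indicator A (g z - x) * indicator B x" "g z"]
        by simp
    qed
    also have "\<dots> = (\<integral>\<^sup>+x. \<integral>\<^sup>+z. indicator B x * indicator A (g z - x) \<partial>lborel \<partial>lborel)"
      by (subst mult.commute, rule pair_sigma_finite.Fubini'[OF I]) measurable
    finally show ?thesis unfolding eq[OF that] eq[OF that(2,1)] .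
  qed
  \<comment> \<open>A test set of measure 1: taking \<open>B = U\<close> in the proportionality
    identifies the factor as the image measure of \<open>U\<close>, finite because the preimage of
    \<open>U\<close> is compact.\<close>
  define U where "U = cbox 0 (One::'a)"
  have [measurable]: "U \<in> sets borel" by (simp add: U_def)
  have U: "emeasure lborel U = 1" by (simp add: U_def emeasure_lborel_cbox_eq)
  have pre: "g -` U = h ` U"
  proof
    show "g -` U \<subseteq> h ` U"
    proof
      fix x assume "x \<in> g -` U"
      then show "x \<in> h ` U" using gh(2)[of x] by (metis image_eqI vimageE)
    qed
    show "h ` U \<subseteq> g -` U" by (auto simp: gh)
  qed
  have "emeasure ?nu U = emeasure lborel (h ` U)"
    by (subst emeasure_distr) (auto simp: pre)
  moreover have "compact (h ` U)" 
    by (rule compact_continuous_image[OF cont(2)]) (simp add: U_def)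
  ultimately have fin: "emeasure ?nu U < \<infinity>" using emeasure_compact_finite by simp
  define c where "c = enn2real (emeasure ?nu U)"
  have c: "emeasure ?nu U = ennreal c" using fin by (simp add: c_def)
  have eq: "emeasure ?nu A = ennreal c * emeasure lborel A" if "A \<in> sets borel" for A
    using proportional[OF that \<open>U \<in> sets borel\<close>] by (simp add: U c mult.commute)
  \<comment> \<open>With factor 0 the image measure would vanish on the whole space, whose preimage
    has infinite measure.\<close>
  have "c > 0"
  proof (rule ccontr)
    assume "\<not> c > 0"
    then have "c = 0" using enn2real_nonneg[of "emeasure ?nu U"] unfolding c_def by linarith
    then have "emeasure ?nu UNIV = 0" using eq[of UNIV] by simp
    moreover have "emeasure ?nu UNIV = emeasure lborel (UNIV::'a set)"
      by (subst emeasure_distr) auto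
    ultimately show False by simp
  qed
  moreover have "?nu = density lborel (\<lambda>_. ennreal c)"
    by (rule measure_eqI) (auto simp: eq emeasure_density nn_integral_cmult)
  ultimately show thesis by (rule that)
qed

text \<open>The factor is the same for all \<open>S\<close> and \<open>f\<close>, so it can be found
  later from a single test integral such as \<open>f = 1\<close>, without computing a determinant.
  It is the reciprocal of the density \<open>k\<close> of the image measure.\<close>

lemma set_lebesgue_integral_affine_image:
  fixes g :: "'a::euclidean_space \<Rightarrow> 'a"
  assumes "linear g" "inj g"
  obtains c where "c > 0"
    "\<And>S (f :: 'a \<Rightarrow> real). compact S \<Longrightarrow> continuous_on UNIV f \<Longrightarrow>
       (LINT x:(\<lambda>x. v + g x) ` S|lborel. f x) = c * (LINT x:S|lborel. f (v + g x))"
proof -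
  obtain k where k: "k > 0" "distr lborel borel g = density lborel (\<lambda>_. ennreal k)"
    using lborel_distr_linear[OF assms] by blast
  have contg: "continuous_on T g" for T
    using assms(1) by (auto intro: linear_continuous_on linear_conv_bounded_linear[THEN iffD1])
  have [measurable]: "g \<in> borel_measurable borel"
    using contg by (rule borel_measurable_continuous_onI)
  have "(LINT x:(\<lambda>x. v + g x) ` S|lborel. f x) = (1 / k) * (LINT x:S|lborel. f (v + g x))"
    if "compact S" and cf: "continuous_on UNIV f" for S and f :: "'a \<Rightarrow> real"
  proof -
    let ?T = "(\<lambda>x. v + g x) ` S"
    have [measurable]: "f \<in> borel_measurable borel"
      using cf by (rule borel_measurable_continuous_onI)
    have "compact ?T"
      by (intro compact_continuous_image continuous_intros contg that)
    then have [measurable]: "?T \<in> sets borel" by (rule borel_compact)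
    have "(LINT x:S|lborel. f (v + g x)) = (\<integral>x. indicator ?T (v + g x) * f (v + g x) \<partial>lborel)"
    proof -
      have "indicator ?T (v + g x) = (indicator S x :: real)" for x
        using inj_image_mem_iff[of "\<lambda>x. v + g x" x S] \<open>inj g\<close>
        by (simp add: indicator_def inj_def)
      then show ?thesis by (simp add: set_lebesgue_integral_def)
    qed
    also have "\<dots> = (\<integral>x. indicator ?T (v + x) * f (v + x) \<partial>distr lborel borel g)"
      by (subst integral_distr) auto
    also have "\<dots> = k * (\<integral>x. indicator ?T (v + x) * f (v + x) \<partial>lborel)"
      unfolding k(2) using k(1) by (subst integral_density) auto
    also have "(\<integral>x. indicator ?T (v + x) * f (v + x) \<partial>lborel) = (\<integral>x. indicator ?T x * f x \<partial>lborel)"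
      by (subst (2) lborel_affine[of "1" v]) 
        (simp_all add: integral_distr density_1)
    finally show ?thesis using k(1) by (simp add: set_lebesgue_integral_def)
  qed
  then show thesis using that[of "1 / k"] k(1) by simp
qed

section \<open>Second moments of simplices\<close>

lemma set_integrable_compact_continuous:
  fixes f :: "'a::euclidean_space \<Rightarrow> real"
  assumes "compact S" "continuous_on UNIV f"
  shows "set_integrable lborel S f"
  unfolding set_integrable_def
  by (rule borel_integrable_compact) (use assms continuous_on_subset in auto)

lemma set_lebesgue_integral_one:
  fixes S :: "'a::euclidean_space set"
  assumes "compact S"
  shows "(LINT x:S|lborel. 1) = measure lborel S"
  using assms by (simp add: set_lebesgue_integral_def borel_compact)

lemma set_integrable_sum:
  fixes f :: "_ \<Rightarrow> _ \<Rightarrow> 'b::{banach, second_countable_topology}"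
  assumes "\<And>i. i \<in> I \<Longrightarrow> set_integrable M A (f i)"
  shows "set_integrable M A (\<lambda>x. \<Sum>i\<in>I. f i x)"
  using assms unfolding set_integrable_def by (simp add: scaleR_sum_right)

lemma set_integral_sum:
  fixes f :: "_ \<Rightarrow> _ \<Rightarrow> 'b::{banach, second_countable_topology}"
  assumes "\<And>i. i \<in> I \<Longrightarrow> set_integrable M A (f i)"
  shows "(LINT x:A|M. (\<Sum>i\<in>I. f i x)) = (\<Sum>i\<in>I. LINT x:A|M. f i x)"
  using assms unfolding set_integrable_def set_lebesgue_integral_def by (simp add: scaleR_sum_right)

section \<open>Barycentric coordinates and second moments of the unit simplex\<close>

definition unit_simplex :: "(real^'n) set" where
  "unit_simplex = {x. (\<forall>i. 0 \<le> x $ i) \<and> (\<Sum>i\<in>UNIV. x $ i) \<le> 1}"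

definition bary :: "'n option \<Rightarrow> real^'n \<Rightarrow> real" where
  "bary i x = (case i of None \<Rightarrow> 1 - (\<Sum>j\<in>UNIV. x $ j) | Some j \<Rightarrow> x $ j)"

lemma bary_simps [simp]:
  "bary None x = 1 - (\<Sum>j\<in>UNIV. x $ j)" "bary (Some j) x = x $ j"
  by (simp_all add: bary_def)

lemma continuous_bary [continuous_intros]: "continuous_on S (bary i)"
  unfolding bary_def by (cases i) (auto intro!: continuous_intros)

lemma sum_UNIV_option: "(\<Sum>i\<in>UNIV. f i) = f None + (\<Sum>i\<in>UNIV. f (Some i))"
  for f :: "'n::finite option \<Rightarrow> 'b::comm_monoid_add"
  by (simp add: UNIV_option_conv sum.reindex)

lemma sum_bary: "(\<Sum>i\<in>UNIV. bary i x) = 1"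
  by (simp add: sum_UNIV_option)

lemma unit_simplex_bary: "unit_simplex = {x. \<forall>i. 0 \<le> bary i x}"
  by (auto simp: unit_simplex_def split_option_all)

lemma unit_simplex_eq_hull: "(unit_simplex :: (real^'n) set) = convex hull (insert 0 (range (\<lambda>i. axis i 1)))"
proof -
  have "(Basis :: (real^'n) set) = range (\<lambda>i. axis i 1)" by (auto simp: Basis_vec_def)
  from std_simplex[where 'a="real^'n", unfolded this] show ?thesis
    by (simp add: unit_simplex_def inner_axis sum.reindex inj_def axis_eq_axis)
qed

lemma compact_unit_simplex: "compact (unit_simplex :: (real^'n) set)"
  unfolding unit_simplex_eq_hull by (intro finite_imp_compact_convex_hull) simp

lemma measure_unit_simplex_pos: "measure lborel (unit_simplex :: (real^'n) set) > 0"
proof -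
  let ?u = "(\<chi> i. 1 / CARD('n)) :: real^'n"
  have "cbox 0 ?u \<subseteq> unit_simplex"
  proof
    fix x assume x: "x \<in> cbox 0 ?u"
    have "(\<Sum>i\<in>UNIV. x $ i) \<le> (\<Sum>i\<in>(UNIV::'n set). 1 / CARD('n))"
      using x by (intro sum_mono) (simp add: mem_box_cart)
    then show "x \<in> unit_simplex" using x by (simp add: unit_simplex_def mem_box_cart)
  qed
  then have "measure lborel (cbox 0 ?u) \<le> measure lborel (unit_simplex :: (real^'n) set)"
    using emeasure_compact_finite[OF compact_unit_simplex[where 'n='n]]
      borel_compact[OF compact_unit_simplex[where 'n='n]]
    by (intro measure_mono_fmeasurable) (simp_all add: fmeasurable_def)
  moreover have "measure lborel (cbox 0 ?u) > 0"
    by (simp add: content_pos_lt_eq Basis_vec_def inner_axis)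
  ultimately show ?thesis by linarith
qed

text \<open>The affine involution that exchanges the vertices 0 and \<open>axis k 1\<close> and
  fixes the others, that is, the transposition of the barycentric coordinates \<open>None\<close>
  and \<open>Some k\<close>.\<close>

definition bary_swap :: "'n \<Rightarrow> real^'n \<Rightarrow> real^'n" where
  "bary_swap k x = (\<chi> i. if i = k then bary None x else x $ i)"

text \<open>The linear map that pulls \<open>axis k 1\<close> to the midpoint of its edge to 0 and
  fixes the other vertices, so that the simplex is carried onto one of its halves.\<close>

definition bary_half :: "'n \<Rightarrow> real^'n \<Rightarrow> real^'n" where
  "bary_half k x = (\<chi> i. if i = k then x $ k / 2 else x $ i)"

lemma sum_if_one:
  fixes f :: "'n::finite \<Rightarrow> real"
  shows "(\<Sum>i\<in>UNIV. if i = k then a else f i) = a - f k + (\<Sum>i\<in>UNIV. f i)"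
  by (simp add: sum.remove[of UNIV k])

lemma bary_bary_swap [simp]:
  "bary None (bary_swap k x) = x $ k"
  "bary_swap k x $ j = (if j = k then bary None x else x $ j)"
  by (simp_all add: bary_swap_def sum_if_one)

lemma bary_swap_swap [simp]: "bary_swap k (bary_swap k x) = x"
  by (simp add: vec_eq_iff del: bary_simps)

lemma bary_bary_half [simp]:
  "bary None (bary_half k x) = bary None x + x $ k / 2"
  "bary_half k x $ j = (if j = k then x $ k / 2 else x $ j)"
  by (simp_all add: bary_half_def sum_if_one)

lemma bary_swap_image: "bary_swap k ` unit_simplex = unit_simplex"
proof -
  have *: "bary_swap k x \<in> unit_simplex" if "x \<in> unit_simplex" for x
    using that by (auto simp: unit_simplex_bary split_option_all simp del: bary_simps(1))
  show ?thesis using * by (metis bary_swap_swap image_eqI image_subsetI subsetI subset_antisym)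
qed

lemma integral_bary_swap:
  fixes f :: "real^'n \<Rightarrow> real"
  assumes "compact S" "continuous_on UNIV f"
  shows "(LINT x:bary_swap k ` S|lborel. f x) = (LINT x:S|lborel. f (bary_swap k x))"
proof -
  define g where "g x = (\<chi> i. if i = k then - (\<Sum>j\<in>UNIV. x $ j) else x $ i)" for x :: "real^'n"
  have "linear g"
    by (rule linearI) (auto simp: g_def vec_eq_iff sum.distrib sum_distrib_left)
  moreover have sw: "bary_swap k x = axis k 1 + g x" for x
    by (auto simp: g_def vec_eq_iff axis_def)
  then have "inj g" by (metis add_left_cancel bary_swap_swap injI)
  ultimately obtain c where c:
    "\<And>S (f :: real^'n \<Rightarrow> real). compact S \<Longrightarrow> continuous_on UNIV f \<Longrightarrow>
       (LINT x:bary_swap k ` S|lborel. f x) = c * (LINT x:S|lborel. f (bary_swap k x))"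
    unfolding sw by (rule set_lebesgue_integral_affine_image[of g "axis k 1"]) blast
  have "c = 1"
    using c[OF compact_unit_simplex, of "\<lambda>_. 1"] measure_unit_simplex_pos[where 'n='n]
    by (simp add: bary_swap_image set_lebesgue_integral_one compact_unit_simplex)
  then show ?thesis using c[OF assms] by simp
qed

text \<open>An integrand invariant under the swap has equal integrals over the two halves of the
  simplex, and one half is the image of the whole under \<open>bary_half\<close>. Testing with the
  constant 1 shows that the volume factor of this map is 1/2.\<close>

lemma integral_bary_half:
  fixes f :: "real^'n \<Rightarrow> real"
  assumes "continuous_on UNIV f" and inv: "\<And>x. f (bary_swap k x) = f x"
  shows "(LINT x:unit_simplex|lborel. f x) = (LINT x:unit_simplex|lborel. f (bary_half k x))"
proof -
  let ?D = "unit_simplex :: (real^'n) set"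
  let ?H = "bary_half k ` ?D"
  have lin: "linear (bary_half k)"
    by (rule linearI) (auto simp: vec_eq_iff field_simps)
  have "inj (bary_half k)" 
  proof (rule injI)
    fix x y :: "real^'n" assume "bary_half k x = bary_half k y"
    then have "bary_half k x $ j = bary_half k y $ j" for j by simp
    then have "x $ j = y $ j" for j by (cases "j = k") (metis bary_bary_half(2) divide_cancel_right zero_neq_numeral)+
    then show "x = y" by (simp add: vec_eq_iff)
  qed
  then obtain c where c:
    "\<And>f :: real^'n \<Rightarrow> real. continuous_on UNIV f \<Longrightarrow>
       (LINT x:?H|lborel. f x) = c * (LINT x:?D|lborel. f (bary_half k x))"
  proof (rule set_lebesgue_integral_affine_image[OF lin, of 0])
    fix c assume "\<And>S (f :: real^'n \<Rightarrow> real). compact S \<Longrightarrow> continuous_on UNIV f \<Longrightarrow>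
       (LINT x:(\<lambda>x. 0 + bary_half k x) ` S|lborel. f x) = c * (LINT x:S|lborel. f (0 + bary_half k x))"
    from this[OF compact_unit_simplex] show thesis by (intro that[of c]) simp
  qed
  have H: "?H = {x \<in> ?D. x $ k \<le> bary None x}"
  proof (intro subset_antisym subsetI)
    fix x assume "x \<in> ?H"
    then show "x \<in> {x \<in> ?D. x $ k \<le> bary None x}"
      by (auto simp: unit_simplex_bary split_option_all simp del: bary_simps(1))
  next
    fix x assume x: "x \<in> {x \<in> ?D. x $ k \<le> bary None x}"
    \<comment> \<open>The preimage under \<open>bary_half\<close>: doubling coordinate
      \<open>k\<close> takes \<open>x $ k\<close> away from the coordinate \<open>None\<close>,
      which stays nonnegative because \<open>x $ k \<le> bary None x\<close>.\<close>
    define y where "y = (\<chi> i. if i = k then 2 * x $ k else x $ i)"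
    have "bary None y = bary None x - x $ k" by (simp add: y_def sum_if_one)
    then have "y \<in> ?D"
      using x by (auto simp: unit_simplex_bary split_option_all y_def simp del: bary_simps(1))
    moreover have "x = bary_half k y" by (simp add: y_def vec_eq_iff)
    ultimately show "x \<in> ?H" by blast
  qed
  have SH: "bary_swap k ` ?H = {x \<in> ?D. bary None x \<le> x $ k}"
  proof -
    have "bary_swap k ` ?H \<subseteq> {x \<in> ?D. bary None x \<le> x $ k}"
      unfolding H using bary_swap_image[of k] by (auto simp del: bary_simps(1))
    moreover have "x \<in> bary_swap k ` ?H" if "x \<in> ?D" "bary None x \<le> x $ k" for x
      unfolding H using that bary_swap_image[of k]
      by (intro image_eqI[of _ _ "bary_swap k x"]) (auto simp del: bary_simps(1))
    ultimately show ?thesis by blast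
  qed
  have ch: "compact ?H"
    using compact_continuous_image[OF linear_continuous_on[OF lin[unfolded linear_conv_bounded_linear]] compact_unit_simplex] .
  have csw: "continuous_on UNIV (bary_swap k)"
    unfolding bary_swap_def
  proof (intro continuous_intros)
    show "continuous_on UNIV (\<lambda>x. if i = k then bary None x else x $ i)" for i
      by (cases "i = k") (simp_all add: continuous_intros del: bary_simps)
  qed
  have cs: "compact (bary_swap k ` ?H)"
    by (rule compact_continuous_image[OF continuous_on_subset[OF csw] ch]) simp
  have un: "?H \<union> bary_swap k ` ?H = ?D" unfolding SH unfolding H by auto
  have ae: "AE x in lborel. \<not> (x \<in> ?H \<and> x \<in> bary_swap k ` ?H)"
  proof -
    \<comment> \<open>The halves meet only where \<open>bary None x = x $ k\<close>, which reads
      \<open>a \<bullet> x = 1\<close>.\<close>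
    define a where "a = ((\<chi> i. (if i = k then 2 else 1)) :: real^'n)"
    have ax: "a \<bullet> x = (\<Sum>j\<in>UNIV. x $ j) + x $ k" for x
    proof -
      have "a \<bullet> x = (\<Sum>i\<in>UNIV. if i = k then 2 * x $ k else x $ i)"
        unfolding a_def inner_vec_def by (intro sum.cong) auto
      then show ?thesis by (simp add: sum_if_one)
    qed
    have "a $ k \<noteq> 0" by (simp add: a_def)
    then have "a \<noteq> 0" by auto
    then have "negligible {x. a \<bullet> x = 1}" by (intro negligible_hyperplane) auto
    then have "{x. a \<bullet> x = 1} \<in> null_sets lborel"
      by (simp add: negligible_iff_null_sets null_sets_completion_iff closed_hyperplane borel_closed)
    then show ?thesis
      by (rule AE_I') (unfold SH, unfold H, auto simp: ax)
  qed
  have half: "(LINT x:?D|lborel. f x) = 2 * c * (LINT x:?D|lborel. f (bary_half k x))"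
    if "continuous_on UNIV f" and inv: "\<And>x. f (bary_swap k x) = f x" for f :: "real^'n \<Rightarrow> real"
  proof -
    have "(LINT x:?H \<union> bary_swap k ` ?H|lborel. f x)
        = (LINT x:?H|lborel. f x) + (LINT x:bary_swap k ` ?H|lborel. f x)"
      by (rule set_integral_Un_AE[OF ae])
        (use ch cs that(1) in \<open>auto intro: set_integrable_compact_continuous simp: borel_compact\<close>)
    then show ?thesis
      unfolding un using integral_bary_swap[OF ch that(1)] inv c[OF that(1)] by simp
  qed
  have "2 * c = 1"
    using half[of "\<lambda>_. 1"] measure_unit_simplex_pos[where 'n='n]
    by (simp add: set_lebesgue_integral_one compact_unit_simplex)
  then show ?thesis using half[OF assms] by simp
qed

text \<open>The hyperplane through the midpoint of an edge and the other vertices cuts the simplex into two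
  halves exchanged by \<open>bary_swap\<close>, each a linear image of the whole simplex. This self-similarity gives
  \<open>\<integral> bary i * bary j = (1/2) \<integral> (bary i)\<^sup>2\<close> for \<open>i \<noteq> j\<close>, and \<open>(\<Sum>i. bary i)\<^sup>2 = 1\<close> fixes the scale.\<close>

lemma integral_bary_bary:
  fixes i j :: "'n::finite option"
  shows "(LINT x:unit_simplex|lborel. bary i x * bary j x)
       = measure lborel (unit_simplex :: (real^'n) set) * (1 + of_bool (i = j))
           / ((CARD('n) + 1) * (CARD('n) + 2))"
proof -
  let ?D = "unit_simplex :: (real^'n) set"
  let ?I = "\<lambda>f :: real^'n \<Rightarrow> real. LINT x:?D|lborel. f x"
  let ?L = "\<lambda>i j. ?I (\<lambda>x. bary i x * bary j x)"
  have int: "set_integrable lborel ?D f" if "continuous_on UNIV f" for f :: "real^'n \<Rightarrow> real"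
    by (rule set_integrable_compact_continuous[OF compact_unit_simplex that])
  have swap: "?I (\<lambda>x. f (bary_swap k x)) = ?I f" if "continuous_on UNIV f" for f k
    using integral_bary_swap[OF compact_unit_simplex that, of k] by (simp add: bary_swap_image)
  have comm: "?L i j = ?L j i" for i j by (simp add: mult.commute)
  have diag: "?L (Some k) (Some k) = ?L None None" for k
    using swap[of "\<lambda>x. bary None x * bary None x" k]
    by (simp add: continuous_intros del: bary_simps(1))
  have zero: "?L None (Some k) = ?L None None / 2" for k
  proof -
    \<comment> \<open>The product of these two coordinates, b0 and bk, is invariant under the swap.
      Pulled back it becomes (b0 + bk / 2) bk / 2, so its integral M satisfies M = M / 2 + D / 4,
      where D is the integral of the square of bk.\<close>
    have "?L None (Some k) = ?I (\<lambda>x. bary None (bary_half k x) * bary (Some k) (bary_half k x))"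
      by (rule integral_bary_half) (auto intro!: continuous_intros simp: mult.commute simp del: bary_simps(1))
    also have "\<dots> = ?I (\<lambda>x. (1/2) * (bary None x * bary (Some k) x)
                         + (1/4) * (bary (Some k) x * bary (Some k) x))"
      unfolding bary_bary_half(1) bary_simps(2) bary_bary_half(2) by (simp add: algebra_simps del: bary_simps)
    also have "\<dots> = ?I (\<lambda>x. (1/2) * (bary None x * bary (Some k) x))
                    + ?I (\<lambda>x. (1/4) * (bary (Some k) x * bary (Some k) x))"
      by (rule set_integral_add(2)) (intro int continuous_intros)+
    also have "\<dots> = (1/2) * ?L None (Some k) + (1/4) * ?L (Some k) (Some k)"
      by (intro arg_cong2[where f="(+)"] set_integral_mult_right)
    finally show ?thesis unfolding diag by linarith
  qed
  have off: "?L (Some k) (Some j) = ?L None None / 2" if "k \<noteq> j" for j k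
    using swap[of "\<lambda>x. bary None x * bary (Some j) x" k] zero[of j] that
    by (simp add: continuous_intros del: bary_simps(1))
  have all: "?L i j = ?L None None / 2 * (1 + of_bool (i = j))" for i j
    by (cases i; cases j) (auto simp: diag zero off comm[of "Some _" None] simp del: bary_simps)
  \<comment> \<open>The square of the sum of all coordinates is 1. Among the (d + 1)^2 index pairs
    the d + 1 diagonal ones count twice, which gives (d + 1) (d + 2) copies of the off-diagonal
    value.\<close>
  have "measure lborel ?D = ?I (\<lambda>x. (\<Sum>i\<in>UNIV. bary i x) * (\<Sum>j\<in>UNIV. bary j x))"
    by (simp add: sum_bary set_lebesgue_integral_one compact_unit_simplex)
  also have "\<dots> = (\<Sum>i\<in>UNIV. \<Sum>j\<in>UNIV. ?L i j)"
    unfolding sum_product 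
    by (simp add: set_integral_sum int continuous_intros set_integrable_sum del: bary_simps)
  also have "\<dots> = (\<Sum>i\<in>UNIV. \<Sum>j\<in>(UNIV :: 'n option set). ?L None None / 2 * (1 + of_bool (i = j)))"
    by (intro sum.cong refl all)
  also have "\<dots> = ?L None None / 2 * ((CARD('n) + 1) * (CARD('n) + 2))"
    unfolding sum_distrib_left[symmetric] by (simp add: sum.distrib algebra_simps)
  finally have *: "measure lborel ?D = ?L None None / 2 * real ((CARD('n) + 1) * (CARD('n) + 2))" .
  have "m = B / 2 * N \<Longrightarrow> N \<noteq> 0 \<Longrightarrow> B = 2 * m / N" for m B N :: real by (simp add: field_simps)
  from this[OF *] have "?L None None = 2 * measure lborel ?D / ((CARD('n) + 1) * (CARD('n) + 2))"
    by (simp only: of_nat_eq_0_iff) simp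
  moreover have "L = B / 2 * t \<Longrightarrow> B = 2 * m / N \<Longrightarrow> L = m * t / N" for L B t m N :: real by simp
  ultimately show ?thesis using all[of i j] by blast
qed

text \<open>The \<open>d + 1\<close> vertices of a simplex in dimension \<open>d = CARD('n)\<close> are indexed by \<open>'n option\<close>.\<close>

definition bary_map :: "('n option \<Rightarrow> real^'n) \<Rightarrow> real^'n \<Rightarrow> real^'n" where
  "bary_map v x = (\<Sum>i\<in>UNIV. bary i x *\<^sub>R v i)"

lemma bary_map_affine:
  "bary_map v x = v None + (\<Sum>i\<in>UNIV. x $ i *\<^sub>R (v (Some i) - v None))"
  by (simp add: bary_map_def sum_UNIV_option algebra_simps sum_subtractf scaleR_sum_left)

lemma bary_map_image: "bary_map v ` unit_simplex = convex hull (range v)"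
proof (intro subset_antisym subsetI)
  fix y assume "y \<in> bary_map v ` unit_simplex"
  then show "y \<in> convex hull (range v)"
    by (auto simp: bary_map_def unit_simplex_bary sum_bary hull_inc simp del: bary_simps
        intro!: convex_sum[OF _ convex_convex_hull])
next
  fix y assume "y \<in> convex hull (range v)"
  have "convex (bary_map v ` unit_simplex)"
  proof -
    have "linear (\<lambda>x :: real^'a. \<Sum>i\<in>UNIV. x $ i *\<^sub>R (v (Some i) - v None))"
      by (intro linearI) (auto simp: algebra_simps sum.distrib scaleR_sum_right sum_subtractf)
    then have "convex ((\<lambda>x. \<Sum>i\<in>UNIV. x $ i *\<^sub>R (v (Some i) - v None)) ` unit_simplex)"
      by (rule convex_linear_image) (simp add: unit_simplex_eq_hull)
    then have "convex ((\<lambda>x. v None + x) ` (\<lambda>x. \<Sum>i\<in>UNIV. x $ i *\<^sub>R (v (Some i) - v None)) ` unit_simplex)"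
      by (rule convex_translation)
    then show ?thesis by (simp add: image_image bary_map_affine[abs_def])
  qed
  moreover have "v i \<in> bary_map v ` unit_simplex" for i
  proof (cases i)
    case None
    then show ?thesis by (intro image_eqI[of _ _ 0]) (auto simp: bary_map_affine unit_simplex_def)
  next
    case (Some k)
    then show ?thesis 
      by (intro image_eqI[of _ _ "axis k 1"])
        (auto simp: bary_map_affine unit_simplex_def axis_def if_distrib[where f="\<lambda>a. a *\<^sub>R _"] cong: if_cong)
  qed
  ultimately show "y \<in> bary_map v ` unit_simplex"
    using \<open>y \<in> convex hull (range v)\<close> hull_minimal[of "range v" "bary_map v ` unit_simplex" convex] 
    by blast
qed

text \<open>The hypothesis says that the edge vectors at \<open>v None\<close> are linearly
  independent. The simplex is the image of the unit simplex under \<open>bary_map v\<close>, the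
  coordinates of a point are linear in its barycentric coordinates, and the Jacobian factor is the
  ratio of the two volumes.\<close>

lemma simplex_moments:
  fixes v :: "'n::finite option \<Rightarrow> real^'n"
  assumes indep: "inj (\<lambda>x :: real^'n. \<Sum>i\<in>UNIV. x $ i *\<^sub>R (v (Some i) - v None))"
  defines "T \<equiv> convex hull (range v)"
  defines "S \<equiv> (\<Sum>i\<in>UNIV. v i)"
  shows "measure lborel T > 0"
    and "(LINT x:T|lborel. x $ a * x $ b) = measure lborel T *
      ((S $ a * S $ b + (\<Sum>i\<in>UNIV. v i $ a * v i $ b)) / ((CARD('n) + 1) * (CARD('n) + 2)))"
    and "(LINT x:T|lborel. x $ a) = measure lborel T * (S $ a / (CARD('n) + 1))"
proof -
  let ?D = "unit_simplex :: (real^'n) set"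
  define N :: real where "N = (CARD('n) + 1) * (CARD('n) + 2)"
  have "linear (\<lambda>x :: real^'n. \<Sum>i\<in>UNIV. x $ i *\<^sub>R (v (Some i) - v None))"
    by (intro linearI) (auto simp: algebra_simps sum.distrib scaleR_sum_right sum_subtractf)
  then obtain c where "c > 0" and
    "\<And>S (f :: real^'n \<Rightarrow> real). compact S \<Longrightarrow> continuous_on UNIV f \<Longrightarrow>
       (LINT x:bary_map v ` S|lborel. f x) = c * (LINT x:S|lborel. f (bary_map v x))"
    unfolding bary_map_affine
    using indep by (rule set_lebesgue_integral_affine_image[where v="v None"]) blast
  note c = this(1) this(2)[OF compact_unit_simplex, unfolded bary_map_image T_def[symmetric]]
  have ct: "compact T" unfolding T_def by (intro finite_imp_compact_convex_hull) simp
  have mT: "measure lborel T = c * measure lborel ?D"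
    using c(2)[of "\<lambda>_. 1"] by (simp add: set_lebesgue_integral_one ct compact_unit_simplex)
  then show "measure lborel T > 0" using c(1) measure_unit_simplex_pos[where 'n='n] by simp
  have int: "set_integrable lborel ?D f" if "continuous_on UNIV f" for f :: "real^'n \<Rightarrow> real"
    by (rule set_integrable_compact_continuous[OF compact_unit_simplex that])
  have quad: "(LINT x:?D|lborel. (\<Sum>i\<in>UNIV. bary i x * p i) * (\<Sum>j\<in>UNIV. bary j x * q j))
     = measure lborel ?D * (((\<Sum>i\<in>UNIV. p i) * (\<Sum>i\<in>UNIV. q i) + (\<Sum>i\<in>UNIV. p i * q i)) / N)" for p q
  proof -
    have "(LINT x:?D|lborel. (\<Sum>i\<in>UNIV. bary i x * p i) * (\<Sum>j\<in>UNIV. bary j x * q j))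
        = (LINT x:?D|lborel. (\<Sum>i\<in>UNIV. \<Sum>j\<in>UNIV. (p i * q j) * (bary i x * bary j x)))"
      unfolding sum_product by (simp add: mult_ac del: bary_simps)
    also have "\<dots> = (\<Sum>i\<in>UNIV. \<Sum>j\<in>UNIV. (p i * q j) * (LINT x:?D|lborel. bary i x * bary j x))"
      by (simp add: set_integral_sum int continuous_intros set_integrable_sum del: bary_simps)
    also have "\<dots> = (\<Sum>i\<in>UNIV. \<Sum>j\<in>UNIV. measure lborel ?D / N * (p i * q j + (if i = j then p i * q j else 0)))"
      unfolding integral_bary_bary N_def by (intro sum.cong refl) simp
    also have "\<dots> = measure lborel ?D / N * ((\<Sum>i\<in>UNIV. \<Sum>j\<in>UNIV. p i * q j) + (\<Sum>i\<in>UNIV. p i * q i))"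
    proof -
      have *: "(\<Sum>i\<in>UNIV. \<Sum>j\<in>UNIV. p i * q j + (if i = j then p i * q j else 0))
          = (\<Sum>i\<in>UNIV. \<Sum>j\<in>UNIV. p i * q j) + (\<Sum>i\<in>UNIV. p i * q i)"
        by (simp add: sum.distrib)
      show ?thesis by (subst *[symmetric]) (simp only: sum_distrib_left)
    qed
    finally show ?thesis
      by (simp only: sum_product times_divide_eq_left times_divide_eq_right)
  qed
  have nth: "bary_map v x $ a = (\<Sum>i\<in>UNIV. bary i x * v i $ a)" for x a
    by (simp add: bary_map_def)
  have S: "S $ a = (\<Sum>i\<in>UNIV. v i $ a)" for a by (simp add: S_def)
  show "(LINT x:T|lborel. x $ a * x $ b) = measure lborel T *
      ((S $ a * S $ b + (\<Sum>i\<in>UNIV. v i $ a * v i $ b)) / ((CARD('n) + 1) * (CARD('n) + 2)))"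
    using quad[of "\<lambda>i. v i $ a" "\<lambda>i. v i $ b"]
    by (subst c(2)) (auto intro!: continuous_intros simp: nth mT S N_def)
  \<comment> \<open>First moments are the case \<open>q = 1\<close> of the quadratic formula,
    because the barycentric coordinates sum to 1; the factor (d + 1) + 1 cancels against
    \<open>N\<close>.\<close>
  have "(LINT x:?D|lborel. bary_map v x $ a) = measure lborel ?D * (S $ a / (CARD('n) + 1))"
  proof -
    have "measure lborel ?D * ((CARD('n) + 2) * S $ a / N) = (LINT x:?D|lborel. bary_map v x $ a)"
      using quad[of "\<lambda>i. v i $ a" "\<lambda>i. 1"] 
      by (simp add: nth sum_bary S algebra_simps del: bary_simps)
    moreover have "m * ((c + 2) * s / ((c + 1) * (c + 2))) = m * (s / (c + 1))"
      if "c \<ge> 0" for m c s :: real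
      using that by (simp add: divide_simps)
    from this[of "real CARD('n)"]
    have "measure lborel ?D * ((CARD('n) + 2) * S $ a / N) = measure lborel ?D * (S $ a / (CARD('n) + 1))"
      by (simp only: N_def of_nat_mult of_nat_add of_nat_1 of_nat_numeral of_nat_0_le_iff)
    ultimately show ?thesis by simp
  qed
  then show "(LINT x:T|lborel. x $ a) = measure lborel T * (S $ a / (CARD('n) + 1))"
    by (subst c(2)) (auto intro!: continuous_intros simp: mT)
qed

section \<open>Cones over the facets of a polytope\<close>

text \<open>Normals are scaled to level 1, which is possible when 0 is an interior point; they are
  then the vertices of the polar polytope. Points on a common ray from 0 can be compared through
  their levels.\<close>

definition facet_normal :: "'a::euclidean_space set \<Rightarrow> 'a set \<Rightarrow> 'a \<Rightarrow> bool" where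
  "facet_normal P F a \<longleftrightarrow> F facet_of P \<and> P \<subseteq> {x. a \<bullet> x \<le> 1} \<and> F = P \<inter> {x. a \<bullet> x = 1}"

lemma dim_le_aff_dim: "int (dim S) \<le> aff_dim S + 1"
proof -
  have "int (dim S) = aff_dim (insert 0 S)"
    by (metis aff_dim_zero dim_span hull_inc insertI1 span_insert_0)
  then show ?thesis by (simp add: aff_dim_insert)
qed

lemma dim_eq_aff_dim:
  assumes "0 \<notin> affine hull S"
  shows "int (dim S) = aff_dim S + 1"
proof -
  have "int (dim S) = aff_dim (insert 0 S)"
    by (metis aff_dim_zero dim_span hull_inc insertI1 span_insert_0)
  then show ?thesis using assms by (simp add: aff_dim_insert)
qed

locale polytope_around_0 =
  fixes P :: "'a::euclidean_space set"
  assumes polytope: "polytope P" and zero_interior: "0 \<in> interior P"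
begin

lemma polyhedron: "polyhedron P" and convex: "convex P" and compact: "compact P"
  using polytope by (auto intro: polytope_imp_polyhedron polytope_imp_convex polytope_imp_compact)

lemma zero_mem: "0 \<in> P"
  using zero_interior interior_subset by auto

lemma aff_dim: "aff_dim P = DIM('a)"
  using zero_interior by (intro aff_dim_nonempty_interior) auto

lemma finite_facets: "finite {F. F facet_of P}"
  using finite_polytope_facets[OF polytope] .

lemma facet_normal_exists:
  assumes F: "F facet_of P"
  obtains a where "facet_normal P F a"
proof -
  have "F exposed_face_of P"
    using F exposed_face_of_polyhedron[OF polyhedron] facet_of_imp_face_of by blast
  then obtain a b where ab: "P \<subseteq> {x. a \<bullet> x \<le> b}" "F = P \<inter> {x. a \<bullet> x = b}"
    unfolding exposed_face_of_def by blast
  \<comment> \<open>Level 0 would put the interior point 0 on \<open>F\<close>, and a face that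
    meets the relative interior is all of \<open>P\<close>.\<close>
  have "b \<noteq> 0"
  proof
    assume "b = 0"
    then have "0 \<in> F \<inter> rel_interior P"
      using ab zero_mem zero_interior interior_subset_rel_interior by auto
    then have "P \<subseteq> F"
      using subset_of_face_of[of F P P] F facet_of_imp_face_of by blast
    then show False using F facet_of_imp_subset by (metis facet_of_irrefl subset_antisym)
  qed
  moreover have "0 \<le> b" using ab(1) zero_mem by auto
  ultimately have "b > 0" by simp
  then have "facet_normal P F ((1 / b) *\<^sub>R a)"
    using F ab unfolding facet_normal_def by (auto simp: field_simps)
  then show thesis by (rule that)
qed

text \<open>The ray from the interior point 0 leaves the bounded set \<open>P\<close> at a frontier
  point, and the frontier is the union of the facets.\<close>

lemma facet_on_ray:
  assumes "x \<noteq> 0"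
  obtains s F where "s > 0" "F facet_of P" "s *\<^sub>R x \<in> F"
proof -
  obtain d where d: "0 < d" "0 + d *\<^sub>R x \<in> frontier P"
    using ray_to_frontier[OF compact_imp_bounded[OF compact] zero_interior assms] by metis
  have "frontier P = \<Union> {F. F facet_of P}"
    using rel_frontier_of_polyhedron[OF polyhedron] rel_frontier_nonempty_interior[of P] zero_interior
    by auto
  then show thesis using d that by auto
qed

lemma facet_scale_ge_1:
  assumes "x \<in> P" "F facet_of P" "s *\<^sub>R x \<in> F" "s > 0"
  shows "s \<ge> 1"
proof -
  obtain a where "facet_normal P F a" using facet_normal_exists[OF assms(2)] .
  then have "a \<bullet> (s *\<^sub>R x) = 1" "a \<bullet> x \<le> 1" using assms unfolding facet_normal_def by blast+
  then have "s * (a \<bullet> x) = 1" by simp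
  then show ?thesis using \<open>a \<bullet> x \<le> 1\<close> \<open>s > 0\<close> by (metis mult.right_neutral mult_le_cancel_left_pos)
qed

text \<open>Only the facet hit by the ray through \<open>x\<close> matters: its inequality at
  \<open>x\<close> forces the scale factor to be at least 1, so \<open>x\<close> lies between 0 and
  a point of that facet.\<close>

lemma mem_if_facet_normals_le:
  assumes "\<And>F. F facet_of P \<Longrightarrow> \<exists>a. facet_normal P F a \<and> a \<bullet> x \<le> 1"
  shows "x \<in> P"
proof (cases "x = 0")
  case False
  then obtain s F where s: "s > 0" "F facet_of P" "s *\<^sub>R x \<in> F" using facet_on_ray by metis
  obtain a where a: "facet_normal P F a" "a \<bullet> x \<le> 1" using assms[OF s(2)] by blast
  then have "a \<bullet> (s *\<^sub>R x) = 1" using s unfolding facet_normal_def by blast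
  then have "s * (a \<bullet> x) = 1" by simp
  then have "s \<ge> 1" using a(2) s(1) by (metis mult.right_neutral mult_le_cancel_left_pos)
  moreover have "s *\<^sub>R x \<in> P" using s facet_of_imp_subset by blast
  ultimately have "(1 - 1/s) *\<^sub>R 0 + (1/s) *\<^sub>R (s *\<^sub>R x) \<in> P"
    using convex zero_mem by (intro convexD) auto
  then show ?thesis using s(1) by simp
qed (use zero_mem in simp)

lemma mem_cone_facet:
  assumes "F facet_of P"
  shows "x \<in> convex hull (insert 0 F) \<longleftrightarrow> (\<exists>f\<in>F. \<exists>t. 0 \<le> t \<and> t \<le> 1 \<and> x = t *\<^sub>R f)"
proof -
  have "F \<noteq> {}" "convex F"
    using assms convex by (auto simp: facet_of_def dest: face_of_imp_convex)
  then have "x \<in> convex hull (insert 0 F) \<longleftrightarrow> (\<exists>u\<ge>0. \<exists>t\<ge>0. u + t = 1 \<and> (\<exists>f\<in>F. x = t *\<^sub>R f))"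
    by (auto simp: convex_hull_insert hull_same)
  also have "\<dots> \<longleftrightarrow> (\<exists>f\<in>F. \<exists>t. 0 \<le> t \<and> t \<le> 1 \<and> x = t *\<^sub>R f)"
  proof
    assume "\<exists>f\<in>F. \<exists>t. 0 \<le> t \<and> t \<le> 1 \<and> x = t *\<^sub>R f"
    then obtain f t where "f \<in> F" "0 \<le> t" "t \<le> 1" "x = t *\<^sub>R f" by blast
    then show "\<exists>u\<ge>0. \<exists>t\<ge>0. u + t = 1 \<and> (\<exists>f\<in>F. x = t *\<^sub>R f)"
      by (intro exI[of _ "1 - t"] conjI exI[of _ t]) auto
  next
    assume "\<exists>u\<ge>0. \<exists>t\<ge>0. u + t = 1 \<and> (\<exists>f\<in>F. x = t *\<^sub>R f)"
    then obtain u t f where "0 \<le> u" "0 \<le> t" "u + t = 1" "f \<in> F" "x = t *\<^sub>R f" by blast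
    then show "\<exists>f\<in>F. \<exists>t. 0 \<le> t \<and> t \<le> 1 \<and> x = t *\<^sub>R f"
      by (intro bexI[of _ f] exI[of _ t]) auto
  qed
  finally show ?thesis .
qed

lemma union_cones: "P = (\<Union>F\<in>{F. F facet_of P}. convex hull (insert 0 F))"
proof (intro subset_antisym subsetI)
  fix x assume x: "x \<in> P"
  show "x \<in> (\<Union>F\<in>{F. F facet_of P}. convex hull (insert 0 F))"
  proof (cases "x = 0")
    case True
    obtain b :: 'a where "b \<in> Basis" using nonempty_Basis by blast
    then obtain s F where "F facet_of P" using facet_on_ray[of b] nonzero_Basis by metis
    then show ?thesis using True by (auto intro!: hull_inc)
  next
    case False
    then obtain s F where s: "s > 0" "F facet_of P" "s *\<^sub>R x \<in> F" using facet_on_ray by metis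
    then have "s \<ge> 1" using facet_scale_ge_1 x by blast
    then have "x \<in> convex hull (insert 0 F)"
      unfolding mem_cone_facet[OF s(2)] using s
      by (intro bexI[of _ "s *\<^sub>R x"] exI[of _ "1 / s"]) auto
    then show ?thesis using s by blast
  qed
next
  fix x assume "x \<in> (\<Union>F\<in>{F. F facet_of P}. convex hull (insert 0 F))"
  then obtain F where F: "F facet_of P" "x \<in> convex hull (insert 0 F)" by blast
  then show "x \<in> P"
    using hull_minimal[of "insert 0 F" P convex] convex zero_mem facet_of_imp_subset[OF F(1)] by auto
qed

text \<open>If x = t f = u g, the normal of \<open>F\<close> gives t = u (a \<bullet> g) \<le> u,
  and that of \<open>G\<close> gives u \<le> t. Hence t = u and f = g: the cones meet only in the
  cone over the common face.\<close>

lemma cone_facets_meet: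
  assumes "F facet_of P" "G facet_of P" "x \<noteq> 0"
    "x \<in> convex hull (insert 0 F)" "x \<in> convex hull (insert 0 G)"
  obtains t f where "t > 0" "f \<in> F \<inter> G" "x = t *\<^sub>R f"
proof -
  obtain f t where f: "f \<in> F" "0 \<le> t" "x = t *\<^sub>R f"
    using assms(4) unfolding mem_cone_facet[OF assms(1)] by blast
  obtain g u where g: "g \<in> G" "0 \<le> u" "x = u *\<^sub>R g"
    using assms(5) unfolding mem_cone_facet[OF assms(2)] by blast
  obtain a where a: "facet_normal P F a" using facet_normal_exists[OF assms(1)] .
  obtain b where b: "facet_normal P G b" using facet_normal_exists[OF assms(2)] .
  have "a \<bullet> f = 1" "a \<bullet> g \<le> 1" "b \<bullet> g = 1" "b \<bullet> f \<le> 1"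
    using a b f(1) g(1) unfolding facet_normal_def by blast+
  moreover have "t * (a \<bullet> f) = u * (a \<bullet> g)" "t * (b \<bullet> f) = u * (b \<bullet> g)"
    using f(3) g(3) by (metis inner_scaleR_right)+
  ultimately have "t = u * (a \<bullet> g)" "u = t * (b \<bullet> f)" "t \<le> u" "u \<le> t"
    using f(2) g(2) by (simp, simp, metis mult.right_neutral mult_left_mono, metis mult.right_neutral mult_left_mono)
  then have "t = u" "t \<noteq> 0" using assms(3) f(3) by auto
  then have "f = g" using f(3) g(3) by simp
  then show thesis using that[of t f] f g \<open>t \<noteq> 0\<close> by simp
qed

lemma facets_Int_face:
  assumes "F facet_of P" "G facet_of P"
  shows "(F \<inter> G) face_of P" "(F \<inter> G) face_of F"
  using assms face_of_Int facet_of_imp_face_of face_of_subset[of "F \<inter> G" P F] facet_of_imp_subset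
  by (blast, metis face_of_Int face_of_subset facet_of_imp_face_of facet_of_imp_subset inf_le1)

lemma aff_dim_facets_Int:
  assumes "F facet_of P" "G facet_of P" "F \<noteq> G"
  shows "aff_dim (F \<inter> G) \<le> int DIM('a) - 2"
proof -
  have "F \<inter> G \<noteq> F"
  proof
    assume "F \<inter> G = F"
    then have "F face_of G" using facets_Int_face(2)[OF assms(2,1)] by (simp add: inf_commute)
    then have "aff_dim F < aff_dim G"
      using face_of_aff_dim_lt[of G F] assms convex
      by (meson face_of_imp_convex facet_of_imp_face_of)
    then show False using assms by (simp add: facet_of_def)
  qed
  then have "aff_dim (F \<inter> G) < aff_dim F"
    using face_of_aff_dim_lt[of F "F \<inter> G"] facets_Int_face(2)[OF assms(1,2)] assms convex
    by (meson face_of_imp_convex facet_of_imp_face_of)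
  then show ?thesis using assms(1) by (simp add: facet_of_def aff_dim)
qed

lemma zero_notin_affine_hull_facet:
  assumes "F facet_of P"
  shows "0 \<notin> affine hull F"
proof
  assume *: "0 \<in> affine hull F"
  obtain a where "facet_normal P F a" using facet_normal_exists[OF assms] .
  then have "F \<subseteq> {x. a \<bullet> x = 1}" by (auto simp: facet_normal_def)
  then have "affine hull F \<subseteq> {x. a \<bullet> x = 1}"
    by (intro hull_minimal) (auto simp: affine_hyperplane)
  then show False using * by auto
qed

text \<open>The affine hull of a facet misses 0, so passing to the linear span gains one dimension.
  Ridges thus span hyperplanes through 0, and smaller intersections span less.\<close>

lemma dim_facets_Int:
  assumes "F facet_of P" "G facet_of P"
  shows "int (dim (F \<inter> G)) = aff_dim (F \<inter> G) + 1"
  using zero_notin_affine_hull_facet[OF assms(1)] hull_mono[of "F \<inter> G" F affine]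
  by (intro dim_eq_aff_dim) auto

lemma negligible_cones_Int:
  assumes "F facet_of P" "G facet_of P" "F \<noteq> G"
  shows "negligible (convex hull (insert 0 F) \<inter> convex hull (insert 0 G))"
proof -
  have "convex hull (insert 0 F) \<inter> convex hull (insert 0 G) \<subseteq> span (F \<inter> G)"
  proof
    fix x assume x: "x \<in> convex hull (insert 0 F) \<inter> convex hull (insert 0 G)"
    show "x \<in> span (F \<inter> G)"
    proof (cases "x = 0")
      case False
      then obtain t f where "f \<in> F \<inter> G" "x = t *\<^sub>R f"
        using cone_facets_meet[OF assms(1,2)] x by (metis IntE)
      then show ?thesis by (simp add: span_base span_scale)
    qed (simp add: span_zero)
  qed
  moreover have "negligible (span (F \<inter> G))"
    using dim_facets_Int[OF assms(1,2)] aff_dim_facets_Int[OF assms] 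
    by (intro negligible_lowdim) simp
  ultimately show ?thesis by (rule negligible_subset[rotated])
qed

lemma cone_avoids_negligible:
  assumes "F facet_of P" "negligible N"
  obtains x where "x \<in> convex hull (insert 0 F)" "x \<notin> N"
proof -
  have "aff_dim (convex hull (insert 0 F)) = DIM('a)"
    using zero_notin_affine_hull_facet[OF assms(1)] assms(1)
    by (simp add: aff_dim_convex_hull aff_dim_insert facet_of_def aff_dim)
  then have "interior (convex hull (insert 0 F)) \<noteq> {}"
    by (simp add: interior_rel_interior_gen rel_interior_eq_empty del: aff_dim_convex_hull)
  then have "\<not> negligible (interior (convex hull (insert 0 F)))"
    using open_not_negligible[OF open_interior] by blast
  then have "\<not> interior (convex hull (insert 0 F)) \<subseteq> N"
    using assms(2) negligible_subset by blast
  then show thesis using that interior_subset by blast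
qed

text \<open>A segment between generic points of two cones over facets misses
  the cones over all faces of codimension at least 3.\<close>

lemma facets_connected:
  assumes sub: "\<G> \<subseteq> {F. F facet_of P}" and ne: "\<G> \<noteq> {}"
    and adj: "\<And>F G. F \<in> \<G> \<Longrightarrow> G facet_of P \<Longrightarrow> F \<noteq> G \<Longrightarrow> aff_dim (F \<inter> G) = int DIM('a) - 2 \<Longrightarrow> G \<in> \<G>"
  shows "\<G> = {F. F facet_of P}"
proof (rule ccontr)
  assume "\<G> \<noteq> {F. F facet_of P}"
  then obtain G0 where G0: "G0 facet_of P" "G0 \<notin> \<G>" using sub by blast
  obtain F0 where F0: "F0 \<in> \<G>" using ne by blast
  let ?FF = "{F. F facet_of P}"
  let ?T = "\<lambda>F. convex hull (insert 0 F)"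
  have not_adj: "aff_dim (F \<inter> G) \<le> int DIM('a) - 3" if "F \<in> \<G>" "G facet_of P" "G \<notin> \<G>" for F G
  proof -
    have "F \<noteq> G" using that by blast
    moreover have "F facet_of P" using that sub by blast
    ultimately show ?thesis using aff_dim_facets_Int[of F G] adj[of F G] that by fastforce
  qed
  \<comment> \<open>Affine dimension is at least -1, the value for the empty set, and a pair of
    non-adjacent facets is at hand. Lines through 0 are therefore negligible.\<close>
  have "DIM('a) \<ge> 2" 
    using not_adj[OF F0 G0] aff_dim_geq[of "F0 \<inter> G0"] by linarith
  \<comment> \<open>The starting point \<open>x\<close> is to avoid 0 and all walls, the spans of
    intersections of two distinct facets.\<close>
  define N where "N = insert 0 (\<Union>(F, G) \<in> {(F, G). F \<in> ?FF \<and> G \<in> ?FF \<and> F \<noteq> G}. span (F \<inter> G))"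
  have fin2: "finite {(F, G). F \<in> ?FF \<and> G \<in> ?FF \<and> Q F G}" for Q
    by (rule finite_subset[OF _ finite_cartesian_product[OF finite_facets finite_facets]]) auto
  have "negligible N"
    unfolding N_def negligible_insert
  proof (intro negligible_Union finite_imageI fin2, clarify)
    fix F G assume "F facet_of P" "G facet_of P" "F \<noteq> G"
    then show "negligible (span (F \<inter> G))"
      using dim_facets_Int[of F G] aff_dim_facets_Int[of F G] 
      by (intro negligible_lowdim) simp
  qed
  then obtain x where x: "x \<in> ?T F0" "x \<notin> N"
    using cone_avoids_negligible[of F0 N] F0 sub by blast
  \<comment> \<open>Intersections of affine dimension at most d - 3 have spans of dimension at most
    d - 2, so their joins with \<open>x\<close> are still negligible. If the target \<open>y\<close>
    avoids these joins, the segment from \<open>x\<close> to \<open>y\<close> cannot cross such an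
    intersection.\<close>
  define M where "M = span {x} \<union> (\<Union>(F, G) \<in> {(F, G). F \<in> ?FF \<and> G \<in> ?FF \<and> 
      aff_dim (F \<inter> G) \<le> int DIM('a) - 3}. span (insert x (F \<inter> G)))"
  have "negligible M"
    unfolding M_def negligible_Un_eq
  proof (intro conjI negligible_Union finite_imageI fin2)
    have "dim {x} \<le> 1" using dim_le_card'[of "{x}"] by simp
    then show "negligible (span {x})" using \<open>DIM('a) \<ge> 2\<close> by (intro negligible_lowdim) simp
  next
    fix S assume "S \<in> (\<lambda>(F, G). span (insert x (F \<inter> G))) ` {(F, G). F \<in> ?FF \<and> G \<in> ?FF \<and> 
      aff_dim (F \<inter> G) \<le> int DIM('a) - 3}"
    then obtain F G where S: "S = span (insert x (F \<inter> G))" "aff_dim (F \<inter> G) \<le> int DIM('a) - 3"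
      by auto
    have "dim (insert x (F \<inter> G)) \<le> dim (F \<inter> G) + 1" by (simp add: dim_insert)
    then show "negligible S"
      using S dim_le_aff_dim[of "F \<inter> G"] by (intro negligible_lowdim) (simp add: dim_span)
  qed
  then obtain y where y: "y \<in> ?T G0" "y \<notin> M"
    using cone_avoids_negligible[of G0 M] G0 by blast
  \<comment> \<open>The cones over \<open>\<G>\<close> and those over the remaining facets form two
    closed sets covering the segment; as it is connected, some point \<open>z\<close> lies in a cone
    of each kind.\<close>
  let ?A = "\<Union>F\<in>\<G>. ?T F" and ?B = "\<Union>F\<in>?FF - \<G>. ?T F"
  have cT: "closed (?T F)" if "F \<in> ?FF" for F
  proof -
    have "compact F" using that compact face_of_imp_compact[of P F] convex facet_of_imp_face_of by blast
    then show ?thesis by (intro compact_imp_closed compact_convex_hull compact_insert)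
  qed
  have "closed ?A" "closed ?B"
    using finite_facets sub cT finite_subset[OF sub finite_facets] by (auto intro!: closed_UN)
  moreover have "closed_segment x y \<subseteq> ?A \<union> ?B"
  proof -
    have "x \<in> P" "y \<in> P" using x y F0 G0 sub union_cones by blast+
    then have "closed_segment x y \<subseteq> P" using convex by (simp add: closed_segment_subset)
    then show ?thesis using union_cones by blast
  qed
  moreover have "x \<in> ?A \<inter> closed_segment x y" "y \<in> ?B \<inter> closed_segment x y" 
    using x y F0 G0 by auto
  ultimately have "?A \<inter> ?B \<inter> closed_segment x y \<noteq> {}"
    using connected_closedD[OF connected_segment(1)[of x y], of ?A ?B] by fast
  then obtain z F G where z: "z \<in> closed_segment x y" "F \<in> \<G>" "G facet_of P" "G \<notin> \<G>"
    "z \<in> ?T F" "z \<in> ?T G" by blast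
  obtain u where u: "z = (1 - u) *\<^sub>R x + u *\<^sub>R y" using z(1) by (auto simp: closed_segment_def)
  have yz: "y \<in> span (insert x S)" if "z \<in> span S" "u \<noteq> 0" for S
  proof -
    have "y = (1 / u) *\<^sub>R (z - (1 - u) *\<^sub>R x)" using u that(2) by (simp add: algebra_simps)
    moreover have "z \<in> span (insert x S)" using that(1) span_mono[of S "insert x S"] by blast
    ultimately show ?thesis by (simp add: span_base span_diff span_scale)
  qed
  have "z \<noteq> 0"
  proof
    assume "z = 0"
    then have "u \<noteq> 0" using u x by (auto simp: N_def)
    then have "y \<in> span (insert x {})" using yz[of "{}"] \<open>z = 0\<close> by (simp add: span_zero)
    then show False using y by (simp add: M_def)
  qed
  moreover have FP: "F facet_of P" using z(2) sub by blast
  ultimately obtain t f where "f \<in> F \<inter> G" "z = t *\<^sub>R f"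
    using cone_facets_meet[OF _ z(3) _ z(5,6)] by metis
  then have zs: "z \<in> span (F \<inter> G)" by (simp add: span_base span_scale)
  have "u \<noteq> 0"
  proof
    assume "u = 0"
    then have "x \<in> span (F \<inter> G)" using u zs by simp
    then show False using x(2) z(2-4) FP unfolding N_def by blast
  qed
  then have "y \<in> span (insert x (F \<inter> G))" using yz zs by blast
  then show False using y(2) z(2-4) FP not_adj[OF z(2-4)] unfolding M_def by blast
qed

end

section \<open>Reflections between adjacent facets\<close>

text \<open>The orthogonal reflection in the hyperplane normal to \<open>n\<close>, as an explicit
  linear map. For \<open>n = 0\<close> it is the identity.\<close>

definition mirror :: "'a::euclidean_space \<Rightarrow> 'a \<Rightarrow> 'a" where
  "mirror n x = x - (2 * (n \<bullet> x) / (n \<bullet> n)) *\<^sub>R n"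

lemma linear_mirror: "linear (mirror n)"
  by (intro linearI) (simp_all add: mirror_def algebra_simps inner_add_right add_divide_distrib)

lemma mirror_mirror [simp]: "mirror n (mirror n x) = x"
  by (cases "n = 0") (simp_all add: mirror_def inner_diff_right algebra_simps)

lemma inner_mirror: "mirror n x \<bullet> mirror n y = x \<bullet> y"
  by (cases "n = 0") 
    (simp_all add: mirror_def inner_diff_right inner_diff_left algebra_simps inner_commute)

lemma inj_mirror: "inj (mirror n)" by (metis injI mirror_mirror)

lemma mirror_image_image [simp]: "mirror n ` mirror n ` S = S"
  by (simp add: image_image)

lemma isometry_mirror: "isometry (mirror n)"
  unfolding isometry_def
proof (intro conjI allI)
  show "surj (mirror n)" by (metis mirror_mirror surjI)
  show "dist (mirror n x) (mirror n y) = dist x y" for x y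
    using inner_mirror[of n "x - y" "x - y"] linear_diff[OF linear_mirror, of n x y]
    by (simp add: dist_norm norm_eq_sqrt_inner)
qed

text \<open>By Cauchy-Schwarz every point of the hyperplane is at distance at least \<bar>n
  \<bullet> x\<bar> / norm n from \<open>x\<close>, and the foot of the perpendicular attains this.
  As the left side mentions only the hyperplane, all its normals give the same
  \<open>mirror\<close>.\<close>

lemma reflection_across_hyperplane:
  assumes "n \<noteq> 0"
  shows "reflection_across {x. n \<bullet> x = 0} = mirror n"
proof
  fix x
  let ?p = "x - ((n \<bullet> x) / (n \<bullet> n)) *\<^sub>R n"
  have cp: "?p = closest_point {x. n \<bullet> x = 0} x"
  proof (rule closest_point_unique)
    show "?p \<in> {x. n \<bullet> x = 0}" using assms by (simp add: inner_diff_right)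
    show "\<forall>z\<in>{x. n \<bullet> x = 0}. dist x ?p \<le> dist x z"
    proof
      fix z assume "z \<in> {x. n \<bullet> x = 0}"
      then have "n \<bullet> (x - z) = n \<bullet> x" by (simp add: inner_diff_right)
      then have "\<bar>n \<bullet> x\<bar> \<le> norm n * norm (x - z)" using Cauchy_Schwarz_ineq2[of n "x - z"] by simp
      then have "\<bar>n \<bullet> x\<bar> / norm n \<le> norm (x - z)" using assms by (simp add: field_simps)
      moreover have "norm ((n \<bullet> x / (n \<bullet> n)) *\<^sub>R n) = \<bar>n \<bullet> x\<bar> / norm n"
        using assms by (simp add: dot_square_norm power2_eq_square)
      ultimately show "dist x ?p \<le> dist x z" by (simp add: dist_norm)
    qed
  qed (simp_all add: convex_hyperplane closed_hyperplane)
  show "reflection_across {x. n \<bullet> x = 0} x = mirror n x"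
    unfolding reflection_across_def mirror_def cp[symmetric] by (simp add: algebra_simps scaleR_2)
qed

text \<open>The first-order condition for local extremality, read off at the vertices of each facet.\<close>

definition vertex_condition :: "real \<Rightarrow> 'a::euclidean_space set \<Rightarrow> bool" where
  "vertex_condition c P \<longleftrightarrow> (\<forall>F. F facet_of P \<longrightarrow>
     (\<exists>C. \<not> affine_dependent C \<and> card C = DIM('a) \<and> F = convex hull C \<and>
          (\<forall>u\<in>C. u \<bullet> u + u \<bullet> (\<Sum>C) = c)))"

lemma facet_of_linear_image:
  assumes "linear f" "inj f"
  shows "f ` F facet_of f ` P \<longleftrightarrow> F facet_of P"
  using assms by (simp add: facet_of_def face_of_linear_image aff_dim_injective_linear_image)

lemma facet_of_mirror_image: "F facet_of mirror n ` P \<longleftrightarrow> mirror n ` F facet_of P"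
  using facet_of_linear_image[OF linear_mirror inj_mirror, of n "mirror n ` F" P] by simp

text \<open>The condition involves only inner products, which reflections preserve. This allows a
  reflected copy of \<open>P\<close> to be compared with \<open>P\<close> itself.\<close>

lemma vertex_condition_mirror:
  fixes P :: "'a::euclidean_space set"
  assumes "vertex_condition c P"
  shows "vertex_condition c (mirror n ` P)"
  unfolding vertex_condition_def
proof (intro allI impI)
  fix F assume "F facet_of mirror n ` P"
  then obtain C where C: "\<not> affine_dependent C" "card C = DIM('a)" "mirror n ` F = convex hull C"
    "\<forall>u\<in>C. u \<bullet> u + u \<bullet> (\<Sum>C) = c"
    using assms unfolding facet_of_mirror_image vertex_condition_def by blast
  have "F = mirror n ` (convex hull C)" unfolding C(3)[symmetric] by simp
  then have "F = convex hull (mirror n ` C)"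
    by (simp add: convex_hull_linear_image[OF linear_mirror])
  moreover have "\<Sum>(mirror n ` C) = mirror n (\<Sum>C)"
    using linear_sum[OF linear_mirror, of n "\<lambda>x. x" C]
    by (simp add: sum.reindex[OF inj_on_subset[OF inj_mirror subset_UNIV]])
  moreover have "\<not> affine_dependent (mirror n ` C)"
    using C(1)
    by (simp add: affine_independent_iff_card card_image[OF inj_on_subset[OF inj_mirror subset_UNIV]]
        aff_dim_injective_linear_image[OF linear_mirror inj_mirror])
  moreover have "card (mirror n ` C) = DIM('a)"
    using C(2) by (simp add: card_image[OF inj_on_subset[OF inj_mirror subset_UNIV]])
  ultimately show "\<exists>C. \<not> affine_dependent C \<and> card C = DIM('a) \<and> F = convex hull C \<and>
          (\<forall>u\<in>C. u \<bullet> u + u \<bullet> (\<Sum>C) = c)"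
    using C(4) by (intro exI[of _ "mirror n ` C"]) (simp add: inner_mirror)
qed

locale critical_polytope = polytope_around_0 +
  fixes c assumes vertex_condition: "vertex_condition c P"
begin

lemma adjacent_facets_mirror:
  assumes F: "F facet_of P" and G: "G facet_of P" and "F \<noteq> G"
    and aff: "aff_dim (F \<inter> G) = int DIM('a) - 2"
  obtains n where "n \<noteq> 0" "affine hull (insert 0 (F \<inter> G)) = {x. n \<bullet> x = 0}" "mirror n ` F = G"
proof -
  obtain C where C: "\<not> affine_dependent C" "card C = DIM('a)" "F = convex hull C"
    "\<forall>u\<in>C. u \<bullet> u + u \<bullet> (\<Sum>C) = c"
    using vertex_condition F unfolding vertex_condition_def by blast
  obtain D where D: "\<not> affine_dependent D" "card D = DIM('a)" "G = convex hull D"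
    "\<forall>u\<in>D. u \<bullet> u + u \<bullet> (\<Sum>D) = c"
    using vertex_condition G unfolding vertex_condition_def by blast
  have fin: "finite C" "finite D" using C D aff_independent_finite by blast+
  obtain B where B: "B \<subseteq> C" "F \<inter> G = convex hull B"
    using facets_Int_face(2)[OF F G] face_of_convex_hull_affine_independent[OF C(1)] C(3) by auto
  obtain B' where B': "B' \<subseteq> D" "F \<inter> G = convex hull B'"
    using facets_Int_face(2)[OF G F] face_of_convex_hull_affine_independent[OF D(1)] D(3) 
    by (auto simp: inf_commute)
  have ind: "\<not> affine_dependent B" "\<not> affine_dependent B'"
    using B B' C D affine_dependent_subset by blast+
  \<comment> \<open>An affinely independent set is the set of extreme points of its hull, so the
    common face has the same vertices seen from either facet.\<close>
  have BB': "B = B'"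
    using extreme_point_of_convex_hull_affine_independent[OF ind(1)]
      extreme_point_of_convex_hull_affine_independent[OF ind(2)] B(2) B'(2) by auto
  have "int (card B) = int DIM('a) - 1"
    using aff_dim_affine_independent[OF ind(1)] aff B(2) aff_dim_convex_hull[of B] by simp
  then have "card (C - B) = 1" "card (D - B) = 1"
    using card_Diff_subset[of B C] card_Diff_subset[of B D] finite_subset[OF B(1) fin(1)] B B' BB' C(2) D(2)
    by auto
  then obtain w w' where "C - B = {w}" "D - B = {w'}" by (meson card_1_singletonE)
  then have w: "C = insert w B" "w \<notin> B" and w': "D = insert w' B" "w' \<notin> B"
    using B B' BB' by auto
  have "w \<noteq> w'" using \<open>F \<noteq> G\<close> C(3) D(3) w w' by auto
  define n where "n = w - w'"
  have "n \<noteq> 0" using \<open>w \<noteq> w'\<close> by (simp add: n_def)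
  define s where "s = \<Sum>B"
  have fB: "finite B" using fin(1) w by simp
  have sums: "\<Sum>C = w + s" "\<Sum>D = w' + s" using w w' fB by (simp_all add: s_def)
  \<comment> \<open>The conditions at \<open>u\<close> in the two facets differ only in
    \<open>u \<bullet> w\<close> against \<open>u \<bullet> w'\<close>.\<close>
  have nB: "n \<bullet> u = 0" if "u \<in> B" for u
  proof -
    have "u \<bullet> u + u \<bullet> (w + s) = u \<bullet> u + u \<bullet> (w' + s)"
      using that C(4) D(4) w w' unfolding sums by auto
    then show ?thesis by (simp add: n_def inner_diff_left inner_diff_right inner_add_right inner_commute)
  qed
  then have "n \<bullet> s = 0" by (simp add: s_def inner_sum_right)
  moreover have "w \<bullet> w + w \<bullet> (w + s) = w' \<bullet> w' + w' \<bullet> (w' + s)"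
    using C(4) D(4) w w' unfolding sums by auto
  \<comment> \<open>The condition at \<open>w\<close> is about 2 \<bar>w\<bar>^2 + w \<bullet> s,
    likewise at \<open>w'\<close>, and both points have the same inner product with
    \<open>s\<close>.\<close>
  ultimately have ww: "w \<bullet> w = w' \<bullet> w'"
    by (simp add: n_def inner_diff_left inner_add_right)
  \<comment> \<open>Equal norms put the midpoint of \<open>w\<close> and \<open>w'\<close> on the
    hyperplane, so \<open>mirror n\<close> moves \<open>w\<close> by exactly
    \<open>- n\<close>.\<close>
  have "n \<bullet> n = 2 * (n \<bullet> w)"
    using ww by (simp add: n_def inner_diff_left inner_diff_right inner_commute)
  then have "2 * (n \<bullet> w) / (n \<bullet> n) = 1"
    using \<open>n \<noteq> 0\<close> by (metis divide_self inner_eq_zero_iff)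
  then have mw: "mirror n w = w'" by (simp only: mirror_def scaleR_one) (simp add: n_def)
  have mB: "mirror n u = u" if "u \<in> B" for u using nB[OF that] by (simp add: mirror_def)
  have "mirror n ` C = D" unfolding w(1) w'(1) using mw mB by (auto simp: image_iff)
  then have "mirror n ` F = G"
    unfolding C(3) D(3) by (simp add: convex_hull_linear_image[OF linear_mirror])
  moreover have "affine hull (insert 0 (F \<inter> G)) = {x. n \<bullet> x = 0}"
  proof -
    have "affine hull (insert 0 (F \<inter> G)) = span (F \<inter> G)"
      by (metis affine_hull_span_0 hull_inc insertI1 span_insert_0)
    moreover have "span (F \<inter> G) = {x. n \<bullet> x = 0}"
    proof (rule dim_eq_span[of _ "{x. n \<bullet> x = 0}", THEN trans])
      have "convex {x. n \<bullet> x = 0}" by (rule convex_hyperplane)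
      then show "F \<inter> G \<subseteq> {x. n \<bullet> x = 0}"
        unfolding B(2) using nB by (intro hull_minimal) auto
      show "dim {x. n \<bullet> x = 0} \<le> dim (F \<inter> G)"
        using dim_facets_Int[OF F G] aff dim_hyperplane[OF \<open>n \<noteq> 0\<close>] by simp
      show "span {x. n \<bullet> x = 0} = {x. n \<bullet> x = 0}"
        by (simp add: span_eq_iff subspace_hyperplane)
    qed
    ultimately show ?thesis by simp
  qed
  ultimately show thesis using that \<open>n \<noteq> 0\<close> by blast
qed

end

text \<open>A nonempty \<open>R\<close> is the intersection of the facets containing it, and one
  facet alone has too large a dimension, so there is a second. A face of the convex set
  \<open>F \<inter> G\<close> of the same dimension is all of it.\<close>

lemma (in polytope_around_0) ridge_between_facets:
  assumes R: "R face_of P" and aff: "aff_dim R = int DIM('a) - 2"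
  obtains F G where "F facet_of P" "G facet_of P" "F \<noteq> G" "R = F \<inter> G"
proof -
  have "\<exists>F G. F facet_of P \<and> G facet_of P \<and> F \<noteq> G \<and> R \<subseteq> F \<inter> G"
  proof (cases "R = {}")
    \<comment> \<open>The empty face has dimension -1, so here d = 1; rays in opposite directions
      hit different facets.\<close>
    case True
    obtain b :: 'a where "b \<in> Basis" using nonempty_Basis by blast
    then have b: "b \<noteq> 0" "- b \<noteq> 0" using nonzero_Basis by auto
    obtain s F where F: "s > 0" "F facet_of P" "s *\<^sub>R b \<in> F" using facet_on_ray[OF b(1)] .
    obtain t G where G: "t > 0" "G facet_of P" "t *\<^sub>R (- b) \<in> G" using facet_on_ray[OF b(2)] .
    obtain a where "facet_normal P F a" using facet_normal_exists[OF F(2)] .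
    then have a: "a \<bullet> x = 1" if "x \<in> F" for x using that by (auto simp: facet_normal_def)
    have "F \<noteq> G"
    proof
      assume "F = G"
      then have "s * (a \<bullet> b) = 1" "t * (a \<bullet> b) = - 1" using a F(3) G(3) by force+
      then show False using F(1) G(1) by (smt (verit) mult_pos_pos mult_nonneg_nonneg zero_less_mult_iff)
    qed
    then show ?thesis using F G True by blast
  next
    case False
    have "R \<noteq> P" using aff aff_dim by auto
    then have int: "R = \<Inter>{F. F facet_of P \<and> R \<subseteq> F}"
      using face_of_polyhedron[OF polyhedron R False] by blast
    obtain F where F: "F facet_of P" "R \<subseteq> F"
      using face_of_polyhedron_subset_facet[OF polyhedron R False \<open>R \<noteq> P\<close>] .
    have "R \<noteq> F" using F(1) aff by (auto simp: facet_of_def aff_dim)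
    then have "\<not> (\<forall>G. G facet_of P \<and> R \<subseteq> G \<longrightarrow> G = F)" using int F by blast
    then show ?thesis using F by blast
  qed
  then obtain F G where FG: "F facet_of P" "G facet_of P" "F \<noteq> G" "R \<subseteq> F \<inter> G" by blast
  have "R face_of F \<inter> G"
    using R FG(4) facets_Int_face(1)[OF FG(1,2)] face_of_subset[of R P "F \<inter> G"] face_of_imp_subset by blast
  moreover have "aff_dim R \<ge> aff_dim (F \<inter> G)" using aff aff_dim_facets_Int[OF FG(1-3)] by simp
  moreover have "convex (F \<inter> G)" using facets_Int_face(1)[OF FG(1,2)] by (rule face_of_imp_convex)
  ultimately have "R = F \<inter> G" using face_of_aff_dim_lt[of "F \<inter> G" R] by fastforce
  then show thesis using that FG by blast
qed

section \<open>Rigidity: one facet determines a critical polytope\<close>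

lemma facets_eq_imp_eq:
  assumes "polytope_around_0 P" "polytope_around_0 Q" "{F. F facet_of P} = {F. F facet_of Q}"
  shows "P = Q"
  using polytope_around_0.union_cones[OF assms(1)] polytope_around_0.union_cones[OF assms(2)] assms(3)
  by simp

text \<open>Common facets are closed under adjacency in \<open>P\<close>: across a ridge of a common
  facet, both polytopes must continue with the mirror image in the same hyperplane. Connectedness
  then reaches every facet of \<open>P\<close>.\<close>

lemma critical_polytopes_facets_subset:
  fixes P Q :: "'a::euclidean_space set"
  assumes P: "critical_polytope P c" and Q: "critical_polytope Q c"
    and F0: "F0 facet_of P" "F0 facet_of Q"
  shows "{F. F facet_of P} \<subseteq> {F. F facet_of Q}"
proof -
  interpret P: critical_polytope P c by (rule P)
  interpret Q: critical_polytope Q c by (rule Q)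
  have "{F. F facet_of P \<and> F facet_of Q} = {F. F facet_of P}"
  proof (rule P.facets_connected)
    fix F G assume "F \<in> {F. F facet_of P \<and> F facet_of Q}" and G: "G facet_of P" "F \<noteq> G"
      and aff: "aff_dim (F \<inter> G) = int DIM('a) - 2"
    then have F: "F facet_of P" "F facet_of Q" by auto
    obtain n where n: "n \<noteq> 0" "affine hull (insert 0 (F \<inter> G)) = {x. n \<bullet> x = 0}" "mirror n ` F = G"
      using P.adjacent_facets_mirror[OF F(1) G aff] .
    have "(F \<inter> G) face_of F" by (rule P.facets_Int_face(2)[OF F(1) G(1)])
    then have R: "(F \<inter> G) face_of Q" using F(2) face_of_trans facet_of_imp_face_of by blast
    obtain F1 F2 where F12: "F1 facet_of Q" "F2 facet_of Q" "F1 \<noteq> F2" "F \<inter> G = F1 \<inter> F2"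
      using Q.ridge_between_facets[OF R aff] .
    obtain H where H: "H facet_of Q" "F \<noteq> H" "F \<inter> G \<subseteq> F \<inter> H" 
      using F12 F by (metis Int_greatest Int_lower1 Int_lower2 le_inf_iff)
    have "aff_dim (F \<inter> H) = int DIM('a) - 2"
      using aff Q.aff_dim_facets_Int[OF F(2) H(1,2)] aff_dim_subset[OF H(3)] by simp
    then obtain m where m: "m \<noteq> 0" "affine hull (insert 0 (F \<inter> H)) = {x. m \<bullet> x = 0}" "mirror m ` F = H"
      using Q.adjacent_facets_mirror[OF F(2) H(1,2)] by blast
    have eq: "F \<inter> G = F \<inter> H"
    proof (rule ccontr)
      assume *: "F \<inter> G \<noteq> F \<inter> H"
      have "(F \<inter> G) face_of (F \<inter> H)" 
        using R H(3) Q.facets_Int_face(1)[OF F(2) H(1)] face_of_subset[of "F \<inter> G" Q "F \<inter> H"] face_of_imp_subset by blast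
      then have "aff_dim (F \<inter> G) < aff_dim (F \<inter> H)"
        using face_of_aff_dim_lt[OF _ _ *] Q.facets_Int_face(1)[OF F(2) H(1)] face_of_imp_convex by blast
      then show False using aff Q.aff_dim_facets_Int[OF F(2) H(1,2)] by simp
    qed
    \<comment> \<open>The normals may differ, but both describe the hyperplane spanned by the ridge
      and 0.\<close>
    have "mirror n = mirror m"
      using reflection_across_hyperplane[OF n(1)] reflection_across_hyperplane[OF m(1)] n(2) m(2) eq by metis
    then have "G = H" using n m by simp
    then show "G \<in> {F. F facet_of P \<and> F facet_of Q}" using G H by simp
  qed (use F0 in auto)
  then show ?thesis by blast
qed

lemma polytope_around_0_mirror:
  assumes "polytope_around_0 P"
  shows "polytope_around_0 (mirror n ` P)"
proof
  show "polytope (mirror n ` P)"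
    using assms polytope_linear_image[OF linear_mirror] unfolding polytope_around_0_def by blast
  show "0 \<in> interior (mirror n ` P)"
    using assms interior_injective_linear_image[OF linear_mirror inj_mirror, of n P]
    by (auto simp: polytope_around_0_def mirror_def image_iff intro!: bexI[of _ 0])
qed

context critical_polytope
begin

text \<open>The reflected polytope satisfies the same vertex condition and has the facet
  \<open>G\<close> in common with \<open>P\<close>; rigidity in both directions identifies the
  two.\<close>

lemma mirror_symmetric:
  assumes F: "F facet_of P" and G: "G facet_of P" and m: "mirror n ` F = G"
  shows "mirror n ` P = P"
proof -
  have P: "critical_polytope P c" by unfold_locales
  have Q: "critical_polytope (mirror n ` P) c"
    unfolding critical_polytope_def critical_polytope_axioms_def
    using polytope_around_0_mirror[OF polytope_around_0_axioms] vertex_condition_mirror[OF vertex_condition] by blast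
  have "G facet_of mirror n ` P" using F m unfolding facet_of_mirror_image by auto
  then have "{F. F facet_of P} = {F. F facet_of mirror n ` P}"
    using critical_polytopes_facets_subset[OF P Q G] critical_polytopes_facets_subset[OF Q P _ G] by blast
  then show ?thesis
    using facets_eq_imp_eq P Q by (metis critical_polytope.axioms(1))
qed

lemma ridge_reflection_symmetric:
  assumes R: "R face_of P" and aff: "aff_dim R = int DIM('a) - 2"
  shows "reflection_across (affine hull (insert 0 R)) ` P = P"
proof -
  obtain F G where FG: "F facet_of P" "G facet_of P" "F \<noteq> G" "R = F \<inter> G"
    using ridge_between_facets[OF R aff] .
  obtain n where "n \<noteq> 0" "affine hull (insert 0 (F \<inter> G)) = {x. n \<bullet> x = 0}" "mirror n ` F = G"
    using adjacent_facets_mirror[OF FG(1-3)] aff FG(4) by metis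
  then show ?thesis
    using mirror_symmetric[OF FG(1,2)] FG(4) by (simp add: reflection_across_hyperplane)
qed

text \<open>The facets that symmetries reach from \<open>F0\<close> are closed under adjacency,
  since the reflection between adjacent facets is itself a symmetry.\<close>

lemma isohedral: "isohedral P"
  unfolding isohedral_def
proof (intro allI impI)
  fix F0 G0 assume *: "F0 facet_of P \<and> G0 facet_of P"
  have "{G. G facet_of P \<and> (\<exists>g\<in>symmetry_group P. g ` F0 = G)} = {F. F facet_of P}"
  proof (rule facets_connected)
    have "id \<in> symmetry_group P" by (auto simp: symmetry_group_def isometry_def)
    then have "\<exists>g\<in>symmetry_group P. g ` F0 = F0" by (intro bexI[of _ id]) simp
    then show "{G. G facet_of P \<and> (\<exists>g\<in>symmetry_group P. g ` F0 = G)} \<noteq> {}" using * by blast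
  next
    fix F G assume "F \<in> {G. G facet_of P \<and> (\<exists>g\<in>symmetry_group P. g ` F0 = G)}"
      and G: "G facet_of P" "F \<noteq> G" and aff: "aff_dim (F \<inter> G) = int DIM('a) - 2"
    then obtain g where g: "F facet_of P" "g \<in> symmetry_group P" "g ` F0 = F" by blast
    obtain n where n: "mirror n ` F = G" using adjacent_facets_mirror[OF g(1) G aff] .
    have "mirror n \<circ> g \<in> symmetry_group P"
    proof -
      have "(mirror n \<circ> g) ` P = P"
        using g(2) mirror_symmetric[OF g(1) G(1) n] unfolding image_comp[symmetric] symmetry_group_def by simp
      then show ?thesis
        using g(2) isometry_mirror[of n] comp_surj[of g "mirror n"]
        by (simp add: symmetry_group_def isometry_def o_def)
    qed
    moreover have "(mirror n \<circ> g) ` F0 = G" using g n unfolding image_comp[symmetric] by simp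
    ultimately show "G \<in> {G. G facet_of P \<and> (\<exists>g\<in>symmetry_group P. g ` F0 = G)}" using G by blast
  qed auto
  then show "\<exists>g\<in>symmetry_group P. g ` F0 = G0" using * by blast
qed

end

section \<open>Moments of bodies\<close>

lemma AE_disjoint_if_negligible:
  fixes A B :: "'a::euclidean_space set"
  assumes "compact A" "compact B" "negligible (A \<inter> B)"
  shows "AE x in lborel. \<not> (x \<in> A \<and> x \<in> B)"
proof -
  have "A \<inter> B \<in> sets borel" using assms(1,2) by (simp add: borel_compact compact_Int)
  then have "A \<inter> B \<in> null_sets lborel"
    using assms(3) by (simp add: negligible_iff_null_sets null_sets_completion_iff)
  then show ?thesis by (rule AE_I') auto
qed

lemma set_integral_Un_negligible:
  fixes f :: "'a::euclidean_space \<Rightarrow> real"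
  assumes "compact A" "compact B" "negligible (A \<inter> B)" "continuous_on UNIV f"
  shows "(LINT x:A \<union> B|lborel. f x) = (LINT x:A|lborel. f x) + (LINT x:B|lborel. f x)"
  using AE_disjoint_if_negligible[OF assms(1-3)] assms
  by (intro set_integral_Un_AE) (auto intro: set_integrable_compact_continuous simp: borel_compact)

lemma set_integral_UN_negligible:
  fixes f :: "'a::euclidean_space \<Rightarrow> real"
  assumes "finite I" "\<And>i. i \<in> I \<Longrightarrow> compact (T i)" "pairwise (\<lambda>i j. negligible (T i \<inter> T j)) I"
    and f: "continuous_on UNIV f"
  shows "(LINT x:(\<Union>i\<in>I. T i)|lborel. f x) = (\<Sum>i\<in>I. LINT x:T i|lborel. f x)"
  using assms(1-3)
proof (induction I)
  case (insert i I)
  have "T i \<inter> (\<Union>j\<in>I. T j) = (\<Union>j\<in>I. T i \<inter> T j)" by blast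
  moreover have "negligible (\<Union>j\<in>I. T i \<inter> T j)"
    using insert by (intro negligible_Union) (auto simp: pairwise_def)
  moreover have "compact (\<Union>j\<in>I. T j)" using insert by (intro compact_UN) auto
  ultimately have "(LINT x:T i \<union> (\<Union>j\<in>I. T j)|lborel. f x)
      = (LINT x:T i|lborel. f x) + (LINT x:(\<Union>j\<in>I. T j)|lborel. f x)"
    using insert f by (intro set_integral_Un_negligible) auto
  then show ?case using insert by (simp add: pairwise_insert)
qed (simp add: set_lebesgue_integral_def)

lemma measure_pos_if_interior:
  fixes S :: "'a::euclidean_space set"
  assumes "compact S" "interior S \<noteq> {}"
  shows "measure lborel S > 0"
proof -
  have "\<not> negligible S"
    using assms(2) open_not_negligible[OF open_interior] negligible_subset[OF _ interior_subset] by blast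
  then have "emeasure lborel S \<noteq> 0"
    using assms(1) by (auto simp: negligible_iff_null_sets null_sets_completion_iff borel_compact null_sets_def)
  then show ?thesis
    using emeasure_compact_finite[OF assms(1)] by (simp add: measure_def enn2real_positive_iff zero_less_iff_neq_zero)
qed

lemma integral_uniform_measure:
  fixes f :: "'a::euclidean_space \<Rightarrow> 'b::{banach, second_countable_topology}"
  assumes "compact K" "measure lborel K > 0" "f \<in> borel_measurable borel"
  shows "(LINT x|uniform_measure lborel K. f x) = (1 / measure lborel K) *\<^sub>R (LINT x:K|lborel. f x)"
proof -
  have [measurable]: "K \<in> sets borel" using assms(1) by (rule borel_compact)
  have e: "emeasure lborel K = ennreal (measure lborel K)"
    using emeasure_compact_finite[OF assms(1)] by (simp add: emeasure_eq_ennreal_measure)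
  have "uniform_measure lborel K = density lborel (\<lambda>x. ennreal (indicator K x / measure lborel K))"
    unfolding uniform_measure_def e using assms(2)
    by (intro arg_cong[where f="density lborel"] ext)
      (auto simp: indicator_def divide_ennreal[symmetric])
  then have "(LINT x|uniform_measure lborel K. f x)
      = (LINT x|lborel. (indicator K x / measure lborel K) *\<^sub>R f x)"
    using assms(2,3) by (simp add: integral_density)
  also have "\<dots> = (LINT x|lborel. (1 / measure lborel K) *\<^sub>R (indicator K x *\<^sub>R f x))"
    by (simp add: field_simps)
  also have "\<dots> = (1 / measure lborel K) *\<^sub>R (LINT x|lborel. indicator K x *\<^sub>R f x)"
    by (rule integral_scaleR_right)
  finally show ?thesis unfolding set_lebesgue_integral_def .
qed

lemma centroid_nth:
  fixes K :: "(real^'n) set"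
  assumes K: "compact K" "measure lborel K > 0"
  shows "centroid K $ i = (LINT x:K|lborel. x $ i) / measure lborel K"
proof -
  have "integrable lborel (\<lambda>x :: real^'n. indicator K x *\<^sub>R x)"
    by (rule borel_integrable_compact[OF K(1)]) (simp add: continuous_on_id)
  then have "(LINT x:K|lborel. x) $ i = (LINT x:K|lborel. x $ i)"
    using integral_bounded_linear[OF bounded_linear_vec_nth[of i], of lborel "\<lambda>x. indicator K x *\<^sub>R x"]
    by (simp add: set_lebesgue_integral_def)
  then show ?thesis
    unfolding centroid_def using integral_uniform_measure[OF K, of "\<lambda>x. x"] by simp
qed

text \<open>Raw moments, unlike central ones, add up over essentially disjoint pieces; this form
  makes the covariance of a union computable.\<close>

lemma covariance_nth:
  fixes K :: "(real^'n) set"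
  assumes K: "compact K" "measure lborel K > 0"
  shows "covariance_matrix K $ i $ j = (LINT x:K|lborel. x $ i * x $ j) / measure lborel K
    - (LINT x:K|lborel. x $ i) * (LINT x:K|lborel. x $ j) / (measure lborel K)\<^sup>2"
proof -
  let ?V = "measure lborel K" and ?m = "centroid K"
  have int: "set_integrable lborel K f" if "continuous_on UNIV f" for f :: "real^'n \<Rightarrow> real"
    by (rule set_integrable_compact_continuous[OF K(1) that])
  have "covariance_matrix K $ i $ j = (LINT x:K|lborel. (x - ?m) $ i * (x - ?m) $ j) / ?V"
    unfolding covariance_matrix_def
    by (simp, subst integral_uniform_measure[OF K])
      (auto intro!: borel_measurable_continuous_onI continuous_intros)
  also have "(LINT x:K|lborel. (x - ?m) $ i * (x - ?m) $ j)
     = (LINT x:K|lborel. x $ i * x $ j + ((- ?m $ j) * x $ i + ((- ?m $ i) * x $ j + ?m $ i * ?m $ j * 1)))"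
    by (simp add: algebra_simps)
  also have "\<dots> = (LINT x:K|lborel. x $ i * x $ j) + ((- ?m $ j) * (LINT x:K|lborel. x $ i)
     + ((- ?m $ i) * (LINT x:K|lborel. x $ j) + ?m $ i * ?m $ j * ?V))"
  proof -
    let ?a = "- ?m $ j" and ?b = "- ?m $ i" and ?c = "?m $ i * ?m $ j"
    have 1: "(LINT x:K|lborel. ?b * x $ j + ?c * 1) = (LINT x:K|lborel. ?b * x $ j) + (LINT x:K|lborel. ?c * 1)"
      by (rule set_integral_add(2)) (intro int continuous_intros)+
    have 2: "(LINT x:K|lborel. ?a * x $ i + (?b * x $ j + ?c * 1))
        = (LINT x:K|lborel. ?a * x $ i) + (LINT x:K|lborel. ?b * x $ j + ?c * 1)"
      by (rule set_integral_add(2)) (intro int continuous_intros)+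
    have 3: "(LINT x:K|lborel. x $ i * x $ j + (?a * x $ i + (?b * x $ j + ?c * 1)))
        = (LINT x:K|lborel. x $ i * x $ j) + (LINT x:K|lborel. ?a * x $ i + (?b * x $ j + ?c * 1))"
      by (rule set_integral_add(2)) (intro int continuous_intros)+
    show ?thesis unfolding 3 2 1 set_integral_mult_right set_lebesgue_integral_one[OF K(1)] ..
  qed
  finally show ?thesis
    using K(2) by (simp add: centroid_nth[OF K] field_simps power2_eq_square)
qed

lemma isotropic_moments:
  fixes K :: "(real^'n) set"
  assumes K: "compact K" "measure lborel K > 0" and iso: "isotropic K"
  shows "(LINT x:K|lborel. x $ i) = 0"
    and "(LINT x:K|lborel. x $ i * x $ j) = measure lborel K * of_bool (i = j)"
proof -
  show 1: "(LINT x:K|lborel. x $ i) = 0" for i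
    using iso K centroid_nth[OF K, of i] by (simp add: isotropic_def)
  show "(LINT x:K|lborel. x $ i * x $ j) = measure lborel K * of_bool (i = j)"
    using iso K covariance_nth[OF K, of i j] by (auto simp: isotropic_def 1 mat_def field_simps)
qed

text \<open>Otherwise a hyperplane through 0 has \<open>K\<close> on one side. The integral of
  \<open>a \<bullet> x\<close> over \<open>K\<close> is then 0 with a nonnegative integrand, so
  almost all of \<open>K\<close> lies in the hyperplane and \<open>K\<close> is a null set.\<close>

lemma zero_in_interior_if_centered:
  fixes K :: "(real^'n) set"
  assumes K: "convex_body K" and c: "centroid K = 0"
  shows "0 \<in> interior K"
proof (rule ccontr)
  assume "0 \<notin> interior K"
  have comp: "compact K" and conv: "convex K" and int: "interior K \<noteq> {}"
    using K by (auto simp: convex_body_def)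
  have V: "measure lborel K > 0" by (rule measure_pos_if_interior[OF comp int])
  obtain a where a: "a \<noteq> 0" "\<forall>x\<in>interior K. 0 \<le> a \<bullet> x"
    using separating_hyperplane_set_0[of "interior K"] convex_interior[OF conv] int \<open>0 \<notin> interior K\<close> by blast
  have aK: "0 \<le> a \<bullet> x" if "x \<in> K" for x
  proof -
    have "closure (interior K) = K"
      using convex_closure_interior[OF conv int] compact_imp_closed[OF comp] by simp
    then have "K \<subseteq> {x. a \<bullet> x \<ge> 0}"
      using a(2) closure_minimal[of "interior K" "{x. a \<bullet> x \<ge> 0}"] closed_halfspace_ge[of 0 a] by auto
    then show ?thesis using that by blast
  qed
  have "(LINT x:K|lborel. a \<bullet> x) = (LINT x:K|lborel. \<Sum>i\<in>UNIV. a $ i * x $ i)"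
    by (simp add: inner_vec_def)
  also have "\<dots> = (\<Sum>i\<in>UNIV. a $ i * (LINT x:K|lborel. x $ i))"
    by (subst set_integral_sum)
      (auto intro!: set_integrable_compact_continuous[OF comp] continuous_intros)
  also have "\<dots> = 0"
    using centroid_nth[OF comp V] c V by simp
  finally have z: "(\<integral>x. indicator K x * (a \<bullet> x) \<partial>lborel) = 0"
    by (simp add: set_lebesgue_integral_def)
  have "integrable lborel (\<lambda>x. indicator K x * (a \<bullet> x))"
    using set_integrable_compact_continuous[OF comp, of "\<lambda>x. a \<bullet> x"] 
    by (simp add: set_integrable_def continuous_intros)
  then have "AE x in lborel. indicator K x * (a \<bullet> x) = 0"
    using z aK by (subst (asm) integral_nonneg_eq_0_iff_AE) (auto simp: indicator_def)
  then have "AE x in lborel. x \<in> K \<longrightarrow> x \<in> {x. a \<bullet> x = 0}"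
    by eventually_elim (auto simp: indicator_def split: if_splits)
  moreover have "negligible {x. a \<bullet> x = 0}" using a(1) by (intro negligible_hyperplane) auto
  then have "{x. a \<bullet> x = 0} \<in> null_sets lborel"
    by (simp add: negligible_iff_null_sets null_sets_completion_iff closed_hyperplane borel_closed)
  then have "AE x in lborel. x \<notin> {x. a \<bullet> x = 0}" by (rule AE_not_in)
  ultimately have "AE x in lborel. x \<notin> K" by eventually_elim auto
  then have "emeasure lborel K = 0"
    using comp by (subst (asm) AE_iff_measurable[of K]) (auto simp: borel_compact)
  then show False using V by (simp add: measure_def)
qed

section \<open>First-order expansion of the determinant at the identity\<close>

lemma prod_one_plus_limit:
  fixes B :: "'b \<Rightarrow> 'i \<Rightarrow> real"
  assumes "finite I" "(e \<longlongrightarrow> 0) F" "eventually (\<lambda>t. e t \<noteq> 0) F" "\<And>i. i \<in> I \<Longrightarrow> ((\<lambda>t. B t i) \<longlongrightarrow> b i) F"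
  shows "((\<lambda>t. ((\<Prod>i\<in>I. 1 + e t * B t i) - 1) / e t) \<longlongrightarrow> (\<Sum>i\<in>I. b i)) F"
  using assms(1,4)
proof (induction I)
  case (insert j I)
  have "((\<lambda>t. \<Prod>i\<in>I. 1 + e t * B t i) \<longlongrightarrow> (\<Prod>i\<in>I. 1 + 0 * b i)) F"
    using insert assms(2) by (intro tendsto_intros) auto
  then have "((\<lambda>t. B t j * (\<Prod>i\<in>I. 1 + e t * B t i) + ((\<Prod>i\<in>I. 1 + e t * B t i) - 1) / e t)
      \<longlongrightarrow> b j * 1 + (\<Sum>i\<in>I. b i)) F"
    using insert by (intro tendsto_intros) auto
  moreover have "eventually (\<lambda>t. B t j * (\<Prod>i\<in>I. 1 + e t * B t i) + ((\<Prod>i\<in>I. 1 + e t * B t i) - 1) / e t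
     = ((\<Prod>i\<in>insert j I. 1 + e t * B t i) - 1) / e t) F"
    using assms(3) by eventually_elim (use insert in \<open>simp add: field_simps\<close>)
  ultimately show ?case using insert tendsto_cong by fastforce
qed simp

text \<open>In the Leibniz formula only the identity permutation contributes to first order, so the
  derivative at the identity matrix is the trace. The direction \<open>B t\<close> is allowed to
  vary with \<open>t\<close>.\<close>

lemma det_one_plus_limit:
  fixes B :: "'b \<Rightarrow> 'n::finite \<Rightarrow> 'n \<Rightarrow> real"
  assumes e: "(e \<longlongrightarrow> 0) F" "eventually (\<lambda>t. e t \<noteq> 0) F" and B: "\<And>i j. ((\<lambda>t. B t i j) \<longlongrightarrow> b i j) F"
  shows "((\<lambda>t. (det (\<chi> i j. of_bool (i = j) + e t * B t i j) - 1) / e t) \<longlongrightarrow> (\<Sum>i\<in>UNIV. b i i)) F"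
proof -
  let ?S = "{p. p permutes (UNIV :: 'n set)}"
  let ?M = "\<lambda>t i j. of_bool (i = j) + e t * B t i j"
  have M: "((\<lambda>t. ?M t i j) \<longlongrightarrow> of_bool (i = j)) F" for i j
    using tendsto_add[OF tendsto_const tendsto_mult[OF e(1) B], of "of_bool (i = j)" i j] by simp
  have id: "id \<in> ?S" by (simp add: permutes_id)
  have nonid: "((\<lambda>t. of_int (sign p) * (\<Prod>i\<in>UNIV. ?M t i (p i)) / e t) \<longlongrightarrow> 0) F"
    if p: "p \<in> ?S - {id}" for p
  proof -
    obtain i where i: "p i \<noteq> i" using p by (auto simp: fun_eq_iff)
    \<comment> \<open>A second moved index: one factor \<open>e t\<close> cancels against the
      division, and the factor at \<open>p i\<close> still tends to 0.\<close>
    have "p (p i) \<noteq> p i" using i p permutes_inj[of p UNIV] by (auto dest: injD)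
    have "((\<lambda>t. of_int (sign p) * (B t i (p i) * (\<Prod>k\<in>UNIV - {i}. ?M t k (p k))))
       \<longlongrightarrow> of_int (sign p) * (b i (p i) * (\<Prod>k\<in>UNIV - {i}. of_bool (k = p k)))) F"
      by (intro tendsto_intros B M)
    moreover have "(\<Prod>k\<in>UNIV - {i}. of_bool (k = p k) :: real) = 0"
      using i \<open>p (p i) \<noteq> p i\<close> by (intro prod_zero bexI[of _ "p i"]) auto
    moreover have "eventually (\<lambda>t. of_int (sign p) * (B t i (p i) * (\<Prod>k\<in>UNIV - {i}. ?M t k (p k)))
      = of_int (sign p) * (\<Prod>i\<in>UNIV. ?M t i (p i)) / e t) F"
      using e(2) 
    proof eventually_elim
      case (elim t)
      have "(\<Prod>i\<in>UNIV. ?M t i (p i)) = ?M t i (p i) * (\<Prod>k\<in>UNIV - {i}. ?M t k (p k))"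
        by (rule prod.remove) auto
      then show ?case using elim i by simp
    qed
    ultimately show ?thesis using tendsto_cong by fastforce
  qed
  have "((\<lambda>t. ((\<Prod>i\<in>UNIV. 1 + e t * B t i i) - 1) / e t
        + (\<Sum>p\<in>?S - {id}. of_int (sign p) * (\<Prod>i\<in>UNIV. ?M t i (p i)) / e t))
      \<longlongrightarrow> (\<Sum>i\<in>UNIV. b i i) + (\<Sum>p\<in>?S - {id}. 0)) F"
    by (intro tendsto_add tendsto_sum nonid prod_one_plus_limit e B) auto
  moreover have "((\<Prod>i\<in>UNIV. 1 + e t * B t i i) - 1) / e t
        + (\<Sum>p\<in>?S - {id}. of_int (sign p) * (\<Prod>i\<in>UNIV. ?M t i (p i)) / e t)
      = (det (\<chi> i j. ?M t i j) - 1) / e t" for t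
    unfolding det_def
    by (subst sum.remove[OF _ id]) 
      (simp_all add: finite_permutations sum_divide_distrib diff_divide_distrib add_divide_distrib)
  ultimately show ?thesis by simp
qed

section \<open>First variation of the isotropic constant\<close>

text \<open>A point of \<open>L\<close> is (1 + t) z with \<open>z\<close> in \<open>K\<close>, at
  distance t \<bar>z\<bar> from \<open>z\<close>; in the other direction the distance is 0 because
  \<open>K \<subseteq> L\<close>.\<close>

lemma hausdorff_dist_le_scaling:
  fixes K :: "'a::euclidean_space set"
  assumes "K \<noteq> {}" "K \<subseteq> L" "L \<subseteq> (\<lambda>x. (1 + t) *\<^sub>R x) ` K" "K \<subseteq> cball 0 R" "t \<ge> 0" "R \<ge> 0"
  shows "hausdorff_dist K L \<le> t * R"
proof -
  have "(SUP x\<in>K. infdist x L) \<le> t * R"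
    using assms by (intro cSUP_least) (auto simp: subset_iff)
  moreover have "(SUP y\<in>L. infdist y K) \<le> t * R"
  proof (rule cSUP_least)
    show "L \<noteq> {}" using assms by auto
    fix y assume "y \<in> L"
    then obtain z where z: "z \<in> K" "y = (1 + t) *\<^sub>R z" using assms(3) by blast
    have "infdist y K \<le> dist y z" by (rule infdist_le[OF z(1)])
    also have "\<dots> = t * norm z" using assms(5) by (simp add: z dist_norm algebra_simps)
    also have "\<dots> \<le> t * R" using assms z(1) by (intro mult_left_mono) (auto simp: subset_iff)
    finally show "infdist y K \<le> t * R" .
  qed
  ultimately show ?thesis by (simp add: hausdorff_dist_def)
qed

lemma measure_lborel_scaling:
  fixes K :: "'a::euclidean_space set"
  assumes "compact K" "t \<ge> 0"
  shows "measure lborel ((\<lambda>x. t *\<^sub>R x) ` K) = t ^ DIM('a) * measure lborel K"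
proof -
  have "compact ((\<lambda>x. t *\<^sub>R x) ` K)" using assms(1) by (rule compact_scaling)
  then show ?thesis
    using measure_lebesgue_affine[of t 0 K] assms by (simp add: measure_completion borel_compact)
qed

text \<open>The points of \<open>C\<close> lie at level 1 of \<open>a\<close> and \<open>p\<close>
  does not. Applying \<open>a\<close> to a vanishing combination makes the coefficients sum to 0,
  and affine independence of \<open>C\<close> then kills them.\<close>

lemma inj_simplex_map:
  fixes v :: "'n::finite \<Rightarrow> real^'n"
  assumes v: "bij_betw v UNIV C" and C: "\<not> affine_dependent C"
    and a: "\<And>u. u \<in> C \<Longrightarrow> a \<bullet> u = 1" "a \<bullet> p \<noteq> 1"
  shows "inj (\<lambda>x :: real^'n. \<Sum>i\<in>UNIV. x $ i *\<^sub>R (v i - p))"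
proof -
  have lin: "linear (\<lambda>x :: real^'n. \<Sum>i\<in>UNIV. x $ i *\<^sub>R (v i - p))"
    by (intro linearI) (auto simp: algebra_simps sum.distrib scaleR_sum_right sum_subtractf)
  show ?thesis
    unfolding linear_injective_0[OF lin]
  proof (intro allI impI)
    fix x :: "real^'n" assume 0: "(\<Sum>i\<in>UNIV. x $ i *\<^sub>R (v i - p)) = 0"
    have av: "a \<bullet> v i = 1" for i using a(1) v by (auto simp: bij_betw_def)
    have "a \<bullet> (\<Sum>i\<in>UNIV. x $ i *\<^sub>R (v i - p)) = (\<Sum>i\<in>UNIV. x $ i) * (1 - a \<bullet> p)"
      by (simp add: inner_sum_right inner_diff_right av sum_distrib_right)
    then have s: "(\<Sum>i\<in>UNIV. x $ i) = 0" using 0 a(2) by simp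
    have "(\<Sum>i\<in>UNIV. x $ i *\<^sub>R (v i - p)) = (\<Sum>i\<in>UNIV. x $ i *\<^sub>R v i) - (\<Sum>i\<in>UNIV. x $ i) *\<^sub>R p"
      by (simp add: scaleR_diff_right sum_subtractf scaleR_sum_left)
    then have sv: "(\<Sum>i\<in>UNIV. x $ i *\<^sub>R v i) = 0" using 0 s by simp
    define U where "U u = x $ (inv_into UNIV v u)" for u
    have Uv: "U (v i) = x $ i" for i using v by (simp add: U_def bij_betw_def)
    have "sum U C = 0" "(\<Sum>u\<in>C. U u *\<^sub>R u) = 0"
      using sum.reindex_bij_betw[OF v, of U] sum.reindex_bij_betw[OF v, of "\<lambda>u. U u *\<^sub>R u"] s sv
      by (simp_all add: Uv)
    then have "\<forall>u\<in>C. U u = 0"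
      using C affine_dependent_explicit_finite[OF aff_independent_finite[OF C]] by blast
    then have "x $ i = 0" for i using Uv[of i] v by (metis UNIV_I bij_betwE)
    then show "x = 0" by (simp add: vec_eq_iff)
  qed
qed

text \<open>The sign \<open>\<sigma>\<close> treats maxima (\<open>\<sigma> = 1\<close>) and minima (\<open>\<sigma> = -1\<close>) simultaneously.\<close>

lemma first_variation:
  fixes P :: "(real^'n) set" and w :: "'b \<Rightarrow> 'n option \<Rightarrow> real^'n" and \<sigma> :: real
  defines "T \<equiv> \<lambda>t. convex hull (range (w t))"
  assumes P: "compact P" "measure lborel P > 0" "isotropic P" and \<sigma>: "\<sigma> = 1 \<or> \<sigma> = -1"
    and nontrivial: "F \<noteq> bot"
    and w: "\<And>i. ((\<lambda>t. w t i) \<longlongrightarrow> w0 i) F"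
    and indep: "eventually (\<lambda>t. inj (\<lambda>x :: real^'n. \<Sum>i\<in>UNIV. x $ i *\<^sub>R (w t (Some i) - w t None))) F"
    and neg: "eventually (\<lambda>t. negligible (P \<inter> T t)) F"
    and vol: "((\<lambda>t. measure lborel (T t)) \<longlongrightarrow> 0) F"
    and ext: "eventually (\<lambda>t. \<sigma> * isotropic_constant (P \<union> T t) \<le> \<sigma> * isotropic_constant P) F"
  shows "\<sigma> * ((\<Sum>i\<in>UNIV. w0 i) \<bullet> (\<Sum>i\<in>UNIV. w0 i) + (\<Sum>i\<in>UNIV. w0 i \<bullet> w0 i))
    \<le> \<sigma> * (real (CARD('n) + 1) * (real (CARD('n) + 2))\<^sup>2)"
proof -
  define V where "V = measure lborel P"
  have V: "V > 0" using P by (simp add: V_def)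
  define e where "e t = measure lborel (T t)" for t
  define d where "d = real CARD('n)"
  define N where "N = (d + 1) * (d + 2)"
  have d: "d > 0" by (simp add: d_def)
  have N: "N > 0" using d by (simp add: N_def)
  define S where "S t = (\<Sum>i\<in>UNIV. w t i)" for t
  \<comment> \<open>\<open>q\<close> and \<open>s\<close> are the mean second and first moments of
    the added simplex; \<open>B\<close> is chosen so that the union has covariance matrix I + e
    B.\<close>
  define q where "q t i j = (S t $ i * S t $ j + (\<Sum>k\<in>UNIV. w t k $ i * w t k $ j)) / N" for t i j
  define s where "s t i = S t $ i / (d + 1)" for t i
  define B where "B t i j = (q t i j - of_bool (i = j)) / (V + e t) - e t * (s t i * s t j) / (V + e t)\<^sup>2" for t i j
  define S0 where "S0 = (\<Sum>i\<in>UNIV. w0 i)"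
  define q0 where "q0 i j = (S0 $ i * S0 $ j + (\<Sum>k\<in>UNIV. w0 k $ i * w0 k $ j)) / N" for i j
  have cT: "compact (T t)" for t unfolding T_def by (intro finite_imp_compact_convex_hull) simp
  have rad_P: "isotropic_constant P = root (2 * CARD('n)) (1 / V\<^sup>2)"
    using P(3) by (simp add: isotropic_constant_def isotropic_def det_I V_def)
  have e0: "(e \<longlongrightarrow> 0) F" using vol by (simp add: e_def[abs_def])
  have epos: "eventually (\<lambda>t. e t > 0) F"
    using indep by eventually_elim (use simplex_moments(1) in \<open>simp add: e_def T_def\<close>)
  \<comment> \<open>The root is strictly monotone, so extremality compares det / volume^2 of the two
    bodies. Since (V + e)^2 / V^2 = 1 + e (2 / V + e / V^2), multiplying out bounds the difference
    quotient of the determinant.\<close>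
  have key: "eventually (\<lambda>t. \<sigma> * ((det (\<chi> i j. of_bool (i = j) + e t * B t i j) - 1) / e t)
      \<le> \<sigma> * (2 / V + e t / V\<^sup>2)) F"
    using indep neg ext epos
  proof eventually_elim
    case (elim t)
    let ?K = "P \<union> T t"
    have Tt: "convex hull (range (w t)) = T t" by (simp add: T_def)
    have cK: "compact ?K" using P cT by (simp add: compact_Un)
    have add: "(LINT x:?K|lborel. f x) = (LINT x:P|lborel. f x) + (LINT x:T t|lborel. f x)"
      if "continuous_on UNIV f" for f :: "real^'n \<Rightarrow> real"
      by (rule set_integral_Un_negligible[OF P(1) cT elim(2) that])
    have mK: "measure lborel ?K = V + e t"
      using add[of "\<lambda>_. 1"] by (simp add: set_lebesgue_integral_one cK P cT V_def e_def)
    have m1: "(LINT x:?K|lborel. x $ i) = e t * s t i" for i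
      using simplex_moments(3)[OF elim(1), of i, unfolded Tt] isotropic_moments(1)[OF P]
      by (subst add) (auto intro!: continuous_intros simp: e_def s_def S_def d_def add.commute)
    have Nd: "real ((CARD('n) + 1) * (CARD('n) + 2)) = N" by (simp add: N_def d_def algebra_simps)
    have m2: "(LINT x:?K|lborel. x $ i * x $ j) = V * of_bool (i = j) + e t * q t i j" for i j
      using simplex_moments(2)[OF elim(1), of i j, unfolded Tt] isotropic_moments(2)[OF P]
      unfolding Nd by (subst add) (auto intro!: continuous_intros simp: e_def q_def S_def V_def)
    have "V + e t > 0" using V elim(4) by simp
    have cov: "covariance_matrix ?K $ i $ j = of_bool (i = j) + e t * B t i j" for i j
    proof -
      have "(V * b + x * q) / (V + x) - (x * r) * (x * u) / (V + x)\<^sup>2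
          = b + x * ((q - b) / (V + x) - x * (r * u) / (V + x)\<^sup>2)" if "V + x > 0" for x q r u b :: real
        using that by (simp add: field_simps power2_eq_square)
      from this[OF \<open>V + e t > 0\<close>] show ?thesis
        unfolding B_def using \<open>V + e t > 0\<close> by (subst covariance_nth[OF cK]) (simp_all only: mK m1 m2)
    qed
    define D where "D = det (\<chi> i j. of_bool (i = j) + e t * B t i j)"
    have "covariance_matrix ?K = (\<chi> i j. of_bool (i = j) + e t * B t i j)"
      by (simp add: vec_eq_iff cov)
    then have "isotropic_constant ?K = root (2 * CARD('n)) (D / (V + e t)\<^sup>2)"
      by (simp add: isotropic_constant_def D_def mK)
    then have "\<sigma> * (D / (V + e t)\<^sup>2) \<le> \<sigma> * (1 / V\<^sup>2)"
      using elim(3) \<sigma> unfolding rad_P by auto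
    moreover have "\<sigma> * ((D - 1) / x) \<le> \<sigma> * (2 / V + x / V\<^sup>2)"
      if "\<sigma> * (D / (V + x)\<^sup>2) \<le> \<sigma> * (1 / V\<^sup>2)" "x > 0" for x
    proof -
      have "\<sigma> * (D / (V + x)\<^sup>2) * (V + x)\<^sup>2 \<le> \<sigma> * (1 / V\<^sup>2) * (V + x)\<^sup>2"
        using that(1) by (rule mult_right_mono) simp
      moreover have "(V + x)\<^sup>2 > 0" using V that(2) by simp
      ultimately have "\<sigma> * D \<le> \<sigma> * ((V + x)\<^sup>2 / V\<^sup>2)" by simp
      also have "(V + x)\<^sup>2 / V\<^sup>2 = 1 + x * (2 / V + x / V\<^sup>2)"
        using V by (simp add: field_simps power2_eq_square)
      finally have "\<sigma> * (D - 1) \<le> \<sigma> * (2 / V + x / V\<^sup>2) * x" by (simp add: algebra_simps)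
      then show ?thesis using that(2) by (simp add: pos_divide_le_eq)
    qed
    ultimately show ?case using elim(4) by (simp add: D_def)
  qed
  have S0: "((\<lambda>t. S t) \<longlongrightarrow> S0) F" unfolding S_def S0_def by (intro tendsto_intros w)
  have "((\<lambda>t. B t i j) \<longlongrightarrow> (q0 i j - of_bool (i = j)) / (V + 0)
      - 0 * (S0 $ i / (d + 1) * (S0 $ j / (d + 1))) / (V + 0)\<^sup>2) F" for i j
    unfolding B_def q_def q0_def s_def using V N d
    by (intro tendsto_intros S0 w e0) auto
  then have B: "((\<lambda>t. B t i j) \<longlongrightarrow> (q0 i j - of_bool (i = j)) / V) F" for i j by simp
  have lim: "((\<lambda>t. (det (\<chi> i j. of_bool (i = j) + e t * B t i j) - 1) / e t)
      \<longlongrightarrow> (\<Sum>i\<in>UNIV. (q0 i i - of_bool (i = i)) / V)) F"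
    by (rule det_one_plus_limit[OF e0 _ B]) (use epos in \<open>auto elim: eventually_mono\<close>)
  have lim2: "((\<lambda>t. \<sigma> * (2 / V + e t / V\<^sup>2)) \<longlongrightarrow> \<sigma> * (2 / V + 0 / V\<^sup>2)) F"
    using V by (intro tendsto_intros e0) auto
  \<comment> \<open>In the limit the trace of (q0 - I) / V is compared with 2 / V, that is, the
    limit of the mean of \<bar>x\<bar>^2 over the simplex with d + 2.\<close>
  have "\<sigma> * (\<Sum>i\<in>UNIV. (q0 i i - of_bool (i = i)) / V) \<le> \<sigma> * (2 / V + 0 / V\<^sup>2)"
    by (rule tendsto_le[OF nontrivial lim2 tendsto_mult_left[OF lim] key])
  then have "\<sigma> * (((\<Sum>i\<in>UNIV. q0 i i) - d) / V) \<le> \<sigma> * (2 / V)"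
    by (simp add: sum_divide_distrib[symmetric] sum_subtractf d_def)
  then have "\<sigma> * (((\<Sum>i\<in>UNIV. q0 i i) - d) / V) * V \<le> \<sigma> * (2 / V) * V"
    using V by (intro mult_right_mono) auto
  moreover have "\<sigma> * (((\<Sum>i\<in>UNIV. q0 i i) - d) / V) * V = \<sigma> * ((\<Sum>i\<in>UNIV. q0 i i) - d)"
    "\<sigma> * (2 / V) * V = \<sigma> * 2" using V by simp_all
  ultimately have "\<sigma> * (\<Sum>i\<in>UNIV. q0 i i) \<le> \<sigma> * (d + 2)"
    by (simp add: algebra_simps)
  moreover have "(\<Sum>i\<in>UNIV. q0 i i) = (S0 \<bullet> S0 + (\<Sum>k\<in>UNIV. w0 k \<bullet> w0 k)) / N"
    unfolding q0_def inner_vec_def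
    by (subst sum.swap) (simp add: sum_divide_distrib[symmetric] sum.distrib)
  ultimately have "\<sigma> * (S0 \<bullet> S0 + (\<Sum>k\<in>UNIV. w0 k \<bullet> w0 k)) \<le> \<sigma> * (d + 2) * N"
    using N by (simp add: field_simps)
  then show ?thesis by (simp add: S0_def N_def d_def power2_eq_square algebra_simps)
qed

section \<open>Tents over the facets of a polytope\<close>

context polytope_around_0
begin

text \<open>A relative interior point of \<open>F\<close> satisfies the inequalities of all other
  facets strictly, and so does a slightly lifted apex. A segment from \<open>P\<close> to the apex
  can then leave \<open>P\<close> only through \<open>F\<close>, so the union with the tent is
  already convex.\<close>

lemma tent_over_facet:
  assumes F: "F facet_of P" "facet_normal P F a" and q: "q \<in> rel_interior F"
  shows "eventually (\<lambda>t. P \<union> convex hull (insert ((1 + t) *\<^sub>R q) F)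
           = convex hull (insert ((1 + t) *\<^sub>R q) P)) (at_right 0)"
proof -
  have "\<exists>b. facet_normal P G b" if "G facet_of P" for G
    using facet_normal_exists[OF that] by blast
  then obtain nrm where nrm: "\<And>G. G facet_of P \<Longrightarrow> facet_normal P G (nrm G)" by metis
  have qF: "q \<in> F" using q rel_interior_subset by blast
  have aq: "a \<bullet> q = 1" and qP: "q \<in> P" using F qF by (auto simp: facet_normal_def)
  have strict: "nrm G \<bullet> q < 1" if "G \<in> {G. G facet_of P} - {F}" for G
  proof -
    have G: "G facet_of P" "G \<noteq> F" using that by auto
    \<comment> \<open>A face of \<open>P\<close> that meets the relative interior of
      \<open>F\<close> contains \<open>F\<close>, which is too much for two distinct facets.\<close>
    have "q \<notin> G"
    proof
      assume "q \<in> G"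
      then have "F \<subseteq> G"
        using subset_of_face_of[of G P F] facet_of_imp_face_of[OF G(1)] facet_of_imp_subset[OF F(1)] q by blast
      then have "F \<inter> G = F" by blast
      then show False using aff_dim_facets_Int[OF F(1) G(1)] G(2) F(1) by (auto simp: facet_of_def aff_dim)
    qed
    then show ?thesis using nrm[OF G(1)] qP by (auto simp: facet_normal_def order.strict_iff_order)
  qed
  have "eventually (\<lambda>t. \<forall>G\<in>{G. G facet_of P} - {F}. (1 + t) * (nrm G \<bullet> q) < 1) (at_right 0)"
  proof (intro eventually_ball_finite ballI finite_Diff finite_facets)
    fix G assume "G \<in> {G. G facet_of P} - {F}"
    have "((\<lambda>t. (1 + t) * (nrm G \<bullet> q)) \<longlongrightarrow> (1 + 0) * (nrm G \<bullet> q)) (at_right 0)"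
      by (intro tendsto_intros)
    then show "eventually (\<lambda>t. (1 + t) * (nrm G \<bullet> q) < 1) (at_right 0)"
      using strict[OF \<open>G \<in> _\<close>] by (intro order_tendstoD(2)) auto
  qed
  moreover have "eventually (\<lambda>t. t > (0::real)) (at_right 0)" by (simp add: eventually_at_right_less)
  ultimately show ?thesis
  proof eventually_elim
    case (elim t)
    let ?p = "(1 + t) *\<^sub>R q"
    have ap: "a \<bullet> ?p = 1 + t" using aq by simp
    show ?case
    proof (intro subset_antisym subsetI)
      fix y assume "y \<in> P \<union> convex hull (insert ?p F)"
      then show "y \<in> convex hull (insert ?p P)"
        using hull_mono[of "insert ?p F" "insert ?p P" convex] facet_of_imp_subset[OF F(1)] hull_inc[of y "insert ?p P"]
        by blast
    next
      fix y assume "y \<in> convex hull (insert ?p P)"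
      have "\<exists>u x. y = (1 - u) *\<^sub>R ?p + u *\<^sub>R x \<and> 0 \<le> u \<and> u \<le> 1 \<and> x \<in> P"
      proof -
        have "P \<noteq> {}" "convex hull P = P" using zero_mem convex by (auto simp: hull_same)
        with \<open>y \<in> _\<close> show ?thesis unfolding convex_hull_insert_alt by auto
      qed
      then obtain r x where "y = (1 - r) *\<^sub>R ?p + r *\<^sub>R x" "0 \<le> r" "r \<le> 1" "x \<in> P" by blast
      then obtain u where ux: "0 \<le> u" "u \<le> 1" "x \<in> P" "y = (1 - u) *\<^sub>R x + u *\<^sub>R ?p"
        using that[of "1 - r"] by (simp add: add.commute)
      have others: "nrm G \<bullet> ((1 - l) *\<^sub>R x + l *\<^sub>R ?p) \<le> 1" if "G facet_of P" "G \<noteq> F" "0 \<le> l" "l \<le> 1" for G l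
      proof -
        have "nrm G \<bullet> x \<le> 1" using nrm[OF that(1)] ux(3) by (auto simp: facet_normal_def)
        moreover have "(1 + t) * (nrm G \<bullet> q) < 1" using elim(1) that(1,2) by blast
        then have "nrm G \<bullet> ?p \<le> 1" by simp
        ultimately have "(1 - l) * (nrm G \<bullet> x) + l * (nrm G \<bullet> ?p) \<le> (1 - l) * 1 + l * 1"
          using that(3,4) by (intro add_mono mult_left_mono) auto
        then show ?thesis by (simp add: inner_add_right)
      qed
      have memP: "(1 - l) *\<^sub>R x + l *\<^sub>R ?p \<in> P"
        if "0 \<le> l" "l \<le> 1" "a \<bullet> ((1 - l) *\<^sub>R x + l *\<^sub>R ?p) \<le> 1" for l
      proof (rule mem_if_facet_normals_le)
        fix G assume G: "G facet_of P"
        show "\<exists>b. facet_normal P G b \<and> b \<bullet> ((1 - l) *\<^sub>R x + l *\<^sub>R ?p) \<le> 1"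
          by (cases "G = F") (use F that others[OF G] nrm[OF G] in blast)+
      qed
      show "y \<in> P \<union> convex hull (insert ?p F)"
      proof (cases "a \<bullet> y \<le> 1")
        case True
        then show ?thesis using memP[of u] ux by simp
      next
        case False
        \<comment> \<open>The parameter at which the segment from \<open>x\<close> to the apex
          crosses level 1 of \<open>a\<close>; the crossing point \<open>z\<close> lies in
          \<open>F\<close>, and \<open>y\<close> lies between \<open>z\<close> and the apex.\<close>
        define l where "l = (1 - a \<bullet> x) / (1 + t - a \<bullet> x)"
        define z where "z = (1 - l) *\<^sub>R x + l *\<^sub>R ?p"
        have ax: "a \<bullet> x \<le> 1" using F(2) ux(3) by (auto simp: facet_normal_def)
        have pos: "1 + t - a \<bullet> x > 0" using ax elim(2) by simp
        have l: "0 \<le> l" "l < 1" using ax pos elim(2) by (simp_all add: l_def)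
        have az': "a \<bullet> ((1 - m) *\<^sub>R x + m *\<^sub>R ?p) = a \<bullet> x + m * (1 + t - a \<bullet> x)" for m
          by (simp add: inner_add_right aq algebra_simps)
        have az: "a \<bullet> z = 1" unfolding z_def az' using pos by (simp add: l_def)
        have "a \<bullet> x + u * (1 + t - a \<bullet> x) > 1" using False unfolding ux(4) az' by simp
        then have "l < u" unfolding l_def using pos by (simp add: field_simps)
        have "z \<in> P" unfolding z_def using l az by (intro memP) (simp_all add: z_def)
        then have "z \<in> F" using az F(2) by (auto simp: facet_normal_def)
        then have "((1 - u) / (1 - l)) *\<^sub>R z + ((u - l) / (1 - l)) *\<^sub>R ?p \<in> convex hull (insert ?p F)"
          using l \<open>l < u\<close> ux(2) by (intro convexD[OF convex_convex_hull] hull_inc) (auto simp: field_simps)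
        moreover have "((1 - u) / (1 - l)) *\<^sub>R z + ((u - l) / (1 - l)) *\<^sub>R ?p = y"
        proof -
          have "((1 - u) / (1 - l)) *\<^sub>R ((1 - l) *\<^sub>R x + l *\<^sub>R p) + ((u - l) / (1 - l)) *\<^sub>R p
             = (1 - u) *\<^sub>R x + ((1 - u) / (1 - l) * l + (u - l) / (1 - l)) *\<^sub>R p" for p
            using l by (simp add: scaleR_add_right scaleR_add_left)
          from this[of ?p] have "((1 - u) / (1 - l)) *\<^sub>R z + ((u - l) / (1 - l)) *\<^sub>R ?p
             = (1 - u) *\<^sub>R x + ((1 - u) / (1 - l) * l + (u - l) / (1 - l)) *\<^sub>R ?p"
            unfolding z_def .
          also have "(1 - u) / (1 - l) * l + (u - l) / (1 - l) = ((1 - u) * l + (u - l)) / (1 - l)"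
            by (simp add: add_divide_distrib)
          also have "(1 - u) * l + (u - l) = u * (1 - l)" by (simp add: algebra_simps)
          also have "u * (1 - l) / (1 - l) = u" using l by simp
          finally show ?thesis using ux(4) by simp
        qed
        ultimately show ?thesis by simp
      qed
    qed
  qed
qed

text \<open>As 0 lies in the convex set \<open>P\<close>, the dilate contains \<open>P\<close>.
  Trapping the perturbed body in it bounds both the Hausdorff distance and the added volume.\<close>

lemma hull_scaled_subset:
  assumes "q \<in> P" "t \<ge> 0"
  shows "convex hull (insert ((1 + t) *\<^sub>R q) P) \<subseteq> (\<lambda>x. (1 + t) *\<^sub>R x) ` P"
proof (rule hull_minimal)
  show "convex ((\<lambda>x. (1 + t) *\<^sub>R x) ` P)" using convex by (rule convex_scaling)
  have "x \<in> (\<lambda>x. (1 + t) *\<^sub>R x) ` P" if "x \<in> P" for x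
  proof (rule image_eqI)
    show "x = (1 + t) *\<^sub>R ((1 / (1 + t)) *\<^sub>R x)" using assms(2) by simp
    have "(1 - 1 / (1 + t)) *\<^sub>R 0 + (1 / (1 + t)) *\<^sub>R x \<in> P"
      using convex zero_mem that assms(2) by (intro convexD) auto
    then show "(1 / (1 + t)) *\<^sub>R x \<in> P" by simp
  qed
  then show "insert ((1 + t) *\<^sub>R q) P \<subseteq> (\<lambda>x. (1 + t) *\<^sub>R x) ` P" using assms(1) by auto
qed

end

text \<open>The apex of a tent tends to \<open>q\<close>, so the limiting vertices in
  \<open>first_variation\<close> are \<open>q\<close> and those in \<open>C\<close>. Tents are built
  over relative interior points; the resulting inequality is a closed condition on \<open>q\<close>
  and so extends to all of \<open>F\<close>, in particular to its vertices.\<close>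

lemma facet_first_order:
  fixes P :: "(real^'n) set" and \<sigma> :: real
  assumes P: "polytope_around_0 P" "isotropic P" and \<sigma>: "\<sigma> = 1 \<or> \<sigma> = -1"
    and ext: "\<epsilon> > 0" "\<And>L. convex_body L \<Longrightarrow> hausdorff_dist P L < \<epsilon> \<Longrightarrow>
      \<sigma> * isotropic_constant L \<le> \<sigma> * isotropic_constant P"
    and F: "F facet_of P" and C: "F = convex hull C" "\<not> affine_dependent C" "card C = CARD('n)"
    and q: "q \<in> F"
  shows "\<sigma> * ((q + \<Sum>C) \<bullet> (q + \<Sum>C) + (q \<bullet> q + (\<Sum>u\<in>C. u \<bullet> u)))
    \<le> \<sigma> * (real (CARD('n) + 1) * (real (CARD('n) + 2))\<^sup>2)"
proof -
  interpret polytope_around_0 P by (rule P(1))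
  have fC: "finite C" using C(2) by (rule aff_independent_finite)
  obtain v :: "'n \<Rightarrow> real^'n" where v: "bij_betw v UNIV C"
    using finite_same_card_bij[of "UNIV :: 'n set" C] fC C(3) by auto
  obtain a where a: "facet_normal P F a" using facet_normal_exists[OF F] .
  have aC: "a \<bullet> u = 1" if "u \<in> C" for u
    using a that hull_inc[of u C] unfolding facet_normal_def C(1) by blast
  have V: "measure lborel P > 0"
    using measure_pos_if_interior[OF compact] zero_interior by blast
  obtain R where R: "P \<subseteq> cball 0 R" "R \<ge> 0"
    using compact_imp_bounded[OF compact] bounded_subset_cball by (metis bounded_iff mem_cball_0 subsetI norm_ge_zero order.trans zero_mem)
  have pos: "eventually (\<lambda>t. t > (0::real)) (at_right 0)" by (simp add: eventually_at_right_less)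
  have interior_case: "\<sigma> * ((q + \<Sum>C) \<bullet> (q + \<Sum>C) + (q \<bullet> q + (\<Sum>u\<in>C. u \<bullet> u)))
    \<le> \<sigma> * (real (CARD('n) + 1) * (real (CARD('n) + 2))\<^sup>2)" if q: "q \<in> rel_interior F" for q
  proof -
    define w where "w t i = (case i of None \<Rightarrow> (1 + t) *\<^sub>R q | Some k \<Rightarrow> v k)" for t i
    define w0 where "w0 i = (case i of None \<Rightarrow> q | Some k \<Rightarrow> v k)" for i
    let ?T = "\<lambda>t. convex hull (range (w t))"
    have qP: "q \<in> P" using q rel_interior_subset facet_of_imp_subset[OF F] by blast
    have aq: "a \<bullet> q = 1" using q rel_interior_subset a unfolding facet_normal_def by blast
    have T: "?T t = convex hull (insert ((1 + t) *\<^sub>R q) F)" for t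
    proof -
      have "range (w t) = insert ((1 + t) *\<^sub>R q) C"
        using v by (auto simp: w_def UNIV_option_conv image_image bij_betw_def)
      then show ?thesis using hull_insert[of convex "(1 + t) *\<^sub>R q" C] C(1) by simp
    qed
    have cT: "compact (?T t)" for t by (intro finite_imp_compact_convex_hull) simp
    have tent: "eventually (\<lambda>t. P \<union> ?T t = convex hull (insert ((1 + t) *\<^sub>R q) P)) (at_right 0)"
      unfolding T by (rule tent_over_facet[OF F a q])
    have neg: "negligible (P \<inter> ?T t)" if "t > 0" for t
    proof -
      have "insert ((1 + t) *\<^sub>R q) F \<subseteq> {x. a \<bullet> x \<ge> 1}"
        using a aq that by (auto simp: facet_normal_def)
      then have "?T t \<subseteq> {x. a \<bullet> x \<ge> 1}"
        unfolding T by (rule hull_minimal) (rule convex_halfspace_ge)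
      then have "P \<inter> ?T t \<subseteq> {x. a \<bullet> x = 1}" using a by (force simp: facet_normal_def)
      moreover have "negligible {x. a \<bullet> x = 1}" using aq by (intro negligible_hyperplane) auto
      ultimately show ?thesis by (rule negligible_subset[rotated])
    qed
    have "\<sigma> * ((\<Sum>i\<in>UNIV. w0 i) \<bullet> (\<Sum>i\<in>UNIV. w0 i) + (\<Sum>i\<in>UNIV. w0 i \<bullet> w0 i))
      \<le> \<sigma> * (real (CARD('n) + 1) * (real (CARD('n) + 2))\<^sup>2)"
    proof (rule first_variation[OF compact V P(2) \<sigma>, of "at_right 0" w])
      show "at_right (0::real) \<noteq> bot" by simp
      show "((\<lambda>t. w t i) \<longlongrightarrow> w0 i) (at_right 0)" for i
      proof (cases i)
        case None
        have "((\<lambda>t. (1 + t) *\<^sub>R q) \<longlongrightarrow> (1 + 0) *\<^sub>R q) (at_right 0)" by (intro tendsto_intros)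
        then show ?thesis using None by (simp add: w_def w0_def)
      qed (simp add: w_def w0_def)
      show "eventually (\<lambda>t. inj (\<lambda>x :: real^'n. \<Sum>i\<in>UNIV. x $ i *\<^sub>R (w t (Some i) - w t None))) (at_right 0)"
        using pos
      proof eventually_elim
        case (elim t)
        then show ?case
          using inj_simplex_map[OF v C(2) aC, of "(1 + t) *\<^sub>R q"] aq by (simp add: w_def)
      qed
      show "eventually (\<lambda>t. negligible (P \<inter> ?T t)) (at_right 0)"
        using pos by eventually_elim (rule neg)
      have body: "P \<union> ?T t \<subseteq> (\<lambda>x. (1 + t) *\<^sub>R x) ` P"
        if "P \<union> ?T t = convex hull (insert ((1 + t) *\<^sub>R q) P)" "t > 0" for t
        unfolding that(1) using hull_scaled_subset[OF qP] that(2) by simp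
      show "((\<lambda>t. measure lborel (?T t)) \<longlongrightarrow> 0) (at_right 0)"
      proof (rule tendsto_sandwich)
        show "eventually (\<lambda>t. 0 \<le> measure lborel (?T t)) (at_right 0)" by simp
        show "eventually (\<lambda>t. measure lborel (?T t) \<le> ((1 + t) ^ CARD('n) - 1) * measure lborel P) (at_right 0)"
          using pos tent
        proof eventually_elim
          case (elim t)
          have "compact ((\<lambda>x. (1 + t) *\<^sub>R x) ` P)" using compact by (rule compact_scaling)
          then have "measure lborel (P \<union> ?T t) \<le> measure lborel ((\<lambda>x. (1 + t) *\<^sub>R x) ` P)"
            using body[OF elim(2,1)] compact cT emeasure_compact_finite
            by (intro measure_mono_fmeasurable) (auto simp: fmeasurable_def borel_compact compact_Un)
          moreover have "measure lborel (P \<union> ?T t) = measure lborel P + measure lborel (?T t)"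
            using set_integral_Un_negligible[OF compact cT neg[OF elim(1)], of "\<lambda>_. 1"]
            by (simp add: set_lebesgue_integral_one compact cT compact_Un)
          moreover have "measure lborel ((\<lambda>x. (1 + t) *\<^sub>R x) ` P) = (1 + t) ^ CARD('n) * measure lborel P"
            using measure_lborel_scaling[OF compact, of "1 + t"] elim(1) by simp
          ultimately show ?case unfolding left_diff_distrib by linarith
        qed
        have "((\<lambda>t. ((1 + t) ^ CARD('n) - 1) * measure lborel P)
          \<longlongrightarrow> ((1 + 0) ^ CARD('n) - 1) * measure lborel P) (at_right 0)"
          by (intro tendsto_intros)
        then show "((\<lambda>t. ((1 + t) ^ CARD('n) - 1) * measure lborel P) \<longlongrightarrow> 0) (at_right 0)" by simp
      qed simp
      have "((\<lambda>t. t * R) \<longlongrightarrow> 0 * R) (at_right 0)" by (intro tendsto_intros)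
      then have "eventually (\<lambda>t. t * R < \<epsilon>) (at_right 0)"
        using ext(1) by (intro order_tendstoD(2)) auto
      then show "eventually (\<lambda>t. \<sigma> * isotropic_constant (P \<union> ?T t) \<le> \<sigma> * isotropic_constant P) (at_right 0)"
        using pos tent
      proof eventually_elim
        case (elim t)
        have "convex_body (P \<union> ?T t)"
          unfolding convex_body_def
        proof (intro conjI)
          show "compact (P \<union> ?T t)" using compact cT by (rule compact_Un)
          show "convex (P \<union> ?T t)" unfolding elim(3) by (rule convex_convex_hull)
          show "interior (P \<union> ?T t) \<noteq> {}" using zero_interior interior_mono[of P "P \<union> ?T t"] by blast
        qed
        moreover have "hausdorff_dist P (P \<union> ?T t) \<le> t * R"
          using hausdorff_dist_le_scaling[OF _ _ body[OF elim(3,2)] R(1)] R(2) elim(2) zero_mem by auto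
        ultimately show ?case using ext(2) elim(1) by simp
      qed
    qed
    moreover have "(\<Sum>i\<in>UNIV. w0 i) = q + \<Sum>C"
      using sum.reindex_bij_betw[OF v, of "\<lambda>u. u"] by (simp add: sum_UNIV_option w0_def)
    moreover have "(\<Sum>i\<in>UNIV. w0 i \<bullet> w0 i) = q \<bullet> q + (\<Sum>u\<in>C. u \<bullet> u)"
      using sum.reindex_bij_betw[OF v, of "\<lambda>u. u \<bullet> u"] by (simp add: sum_UNIV_option w0_def)
    ultimately show ?thesis by simp
  qed
  let ?S = "{q. \<sigma> * ((q + \<Sum>C) \<bullet> (q + \<Sum>C) + (q \<bullet> q + (\<Sum>u\<in>C. u \<bullet> u)))
    \<le> \<sigma> * (real (CARD('n) + 1) * (real (CARD('n) + 2))\<^sup>2)}"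
  have "closed ?S" by (intro closed_Collect_le continuous_intros)
  moreover have "rel_interior F \<subseteq> ?S" using interior_case by blast
  ultimately have "closure (rel_interior F) \<subseteq> ?S" by (rule closure_minimal[rotated])
  moreover have "closure (rel_interior F) = closure F"
    using convex_closure_rel_interior[of F] unfolding C(1) by simp
  ultimately show ?thesis using q closure_subset by blast
qed

section \<open>From inequalities at the vertices to equalities\<close>

lemma vertex_condition_if_extremal:
  fixes P :: "(real^'n) set" and \<sigma> :: real
  assumes P: "polytope_around_0 P" "isotropic P" and \<sigma>: "\<sigma> = 1 \<or> \<sigma> = -1"
    and ext: "\<epsilon> > 0" "\<And>L. convex_body L \<Longrightarrow> hausdorff_dist P L < \<epsilon> \<Longrightarrow>
      \<sigma> * isotropic_constant L \<le> \<sigma> * isotropic_constant P"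
    and simplicial: "simplicial P"
  shows "vertex_condition (real (CARD('n) + 1) * real (CARD('n) + 2)) P"
proof -
  interpret polytope_around_0 P by (rule P(1))
  define d where "d = real CARD('n)"
  have d: "d > 0" by (simp add: d_def)
  have V: "measure lborel P > 0"
    using measure_pos_if_interior[OF compact] zero_interior by blast
  let ?FF = "{F. F facet_of P}"
  have "\<exists>C. \<not> affine_dependent C \<and> card C = CARD('n) \<and> F = convex hull C" if F: "F facet_of P" for F
  proof -
    obtain n C where C: "\<not> affine_dependent C" "int (card C) = n + 1" "F = convex hull C"
      using simplicial F unfolding simplicial_def simplex_def by blast
    have "aff_dim F = int (card C) - 1"
      using aff_dim_affine_independent[OF C(1)] C(3) by (simp add: aff_dim_convex_hull)
    then have "card C = CARD('n)" using F by (simp add: facet_of_def aff_dim)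
    then show ?thesis using C by blast
  qed
  then obtain C where C: "\<And>F. F \<in> ?FF \<Longrightarrow> \<not> affine_dependent (C F)"
    "\<And>F. F \<in> ?FF \<Longrightarrow> card (C F) = CARD('n)" "\<And>F. F \<in> ?FF \<Longrightarrow> convex hull (C F) = F"
    by (metis mem_Collect_eq)
  let ?T = "\<lambda>F. convex hull (insert 0 F)"
  \<comment> \<open>This is (d + 1) (d + 2) times the mean of \<bar>x\<bar>^2 over the cone from 0
    over \<open>F\<close>; the vertex 0 contributes nothing to the moment formula.\<close>
  define g where "g F = \<Sum>(C F) \<bullet> \<Sum>(C F) + (\<Sum>u\<in>C F. u \<bullet> u)" for F
  have cT: "compact (?T F)" if "F \<in> ?FF" for F
  proof -
    have "compact (convex hull (C F))"
      by (intro finite_imp_compact_convex_hull aff_independent_finite C(1)[OF that])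
    then have "compact F" using C(3)[OF that] by simp
    then show ?thesis by (intro compact_convex_hull compact_insert)
  qed
  have cone: "measure lborel (?T F) > 0"
    "(LINT x:?T F|lborel. x \<bullet> x) = measure lborel (?T F) * (g F / ((d + 1) * (d + 2)))" if F: "F \<in> ?FF" for F
  proof -
    have fC: "finite (C F)" by (rule aff_independent_finite[OF C(1)[OF F]])
    obtain v :: "'n \<Rightarrow> real^'n" where v: "bij_betw v UNIV (C F)"
      using finite_same_card_bij[of "UNIV :: 'n set" "C F"] fC C(2)[OF F] by auto
    obtain a where a: "facet_normal P F a" using facet_normal_exists F by blast
    have aC: "a \<bullet> u = 1" if "u \<in> C F" for u
      using a hull_inc[OF that, of convex] C(3)[OF F] by (auto simp: facet_normal_def)
    define w where "w i = (case i of None \<Rightarrow> 0 | Some k \<Rightarrow> v k)" for i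
    have "range w = insert 0 (C F)"
      using v by (auto simp: w_def UNIV_option_conv image_image bij_betw_def)
    then have T: "convex hull (range w) = ?T F"
      using hull_insert[of convex 0 "C F"] C(3)[OF F] by simp
    have inj: "inj (\<lambda>x :: real^'n. \<Sum>i\<in>UNIV. x $ i *\<^sub>R (w (Some i) - w None))"
      using inj_simplex_map[OF v C(1)[OF F] aC, of 0] by (simp add: w_def)
    note mom = simplex_moments[OF inj, unfolded T]
    show "measure lborel (?T F) > 0" by (rule mom(1))
    have S: "(\<Sum>i\<in>UNIV. w i) = \<Sum>(C F)" "(\<Sum>i\<in>UNIV. w i \<bullet> w i) = (\<Sum>u\<in>C F. u \<bullet> u)"
      using sum.reindex_bij_betw[OF v, of "\<lambda>u. u"] sum.reindex_bij_betw[OF v, of "\<lambda>u. u \<bullet> u"]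
      by (simp_all add: sum_UNIV_option w_def)
    have Nd: "real ((CARD('n) + 1) * (CARD('n) + 2)) = (d + 1) * (d + 2)"
      by (simp add: d_def algebra_simps)
    have "(LINT x:?T F|lborel. x \<bullet> x) = (LINT x:?T F|lborel. (\<Sum>i\<in>UNIV. x $ i * x $ i))"
      by (simp add: inner_vec_def)
    also have "\<dots> = (\<Sum>i\<in>UNIV. (LINT x:?T F|lborel. x $ i * x $ i))"
      by (rule set_integral_sum)
        (auto intro!: set_integrable_compact_continuous[OF cT[OF F]] continuous_intros)
    also have "\<dots> = measure lborel (?T F) * ((\<Sum>i\<in>UNIV. (\<Sum>k\<in>UNIV. w k) $ i * (\<Sum>k\<in>UNIV. w k) $ i
        + (\<Sum>k\<in>UNIV. w k $ i * w k $ i)) / ((d + 1) * (d + 2)))"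
      unfolding mom(2) Nd by (simp add: sum_distrib_left sum_divide_distrib)
    also have "(\<Sum>i\<in>UNIV. (\<Sum>k\<in>UNIV. w k) $ i * (\<Sum>k\<in>UNIV. w k) $ i + (\<Sum>k\<in>UNIV. w k $ i * w k $ i))
        = (\<Sum>k\<in>UNIV. w k) \<bullet> (\<Sum>k\<in>UNIV. w k) + (\<Sum>k\<in>UNIV. w k \<bullet> w k)"
      using sum.swap[of "\<lambda>i k. w k $ i * w k $ i" UNIV UNIV] by (simp add: inner_vec_def sum.distrib)
    finally show "(LINT x:?T F|lborel. x \<bullet> x) = measure lborel (?T F) * (g F / ((d + 1) * (d + 2)))"
      by (simp add: S g_def)
  qed
  have pw: "pairwise (\<lambda>F G. negligible (?T F \<inter> ?T G)) ?FF"
    unfolding pairwise_def using negligible_cones_Int by blast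
  have decompose: "(LINT x:P|lborel. f x) = (\<Sum>F\<in>?FF. LINT x:?T F|lborel. f x)"
    if "continuous_on UNIV f" for f :: "real^'n \<Rightarrow> real"
    using set_integral_UN_negligible[OF finite_facets cT pw that] union_cones by simp
  have "measure lborel P = (\<Sum>F\<in>?FF. measure lborel (?T F))"
    using decompose[of "\<lambda>_. 1"] cT by (simp add: set_lebesgue_integral_one compact)
  moreover have "(LINT x:P|lborel. x \<bullet> x) = d * measure lborel P"
  proof -
    have "(LINT x:P|lborel. x \<bullet> x) = (LINT x:P|lborel. (\<Sum>i\<in>UNIV. x $ i * x $ i))"
      by (simp add: inner_vec_def)
    also have "\<dots> = (\<Sum>i\<in>UNIV. (LINT x:P|lborel. x $ i * x $ i))"
      by (rule set_integral_sum)
        (auto intro!: set_integrable_compact_continuous[OF compact] continuous_intros)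
    also have "\<dots> = d * measure lborel P"
      unfolding isotropic_moments(2)[OF compact V P(2)] by (simp add: d_def)
    finally show ?thesis .
  qed
  \<comment> \<open>The mean of \<bar>x\<bar>^2 over \<open>P\<close> is the trace d of the identity
    covariance, and it is the volume-weighted average of the means over the cones.\<close>
  ultimately have total: "(\<Sum>F\<in>?FF. measure lborel (?T F) * (g F / ((d + 1) * (d + 2)) - d)) = 0"
    using decompose[of "\<lambda>x. x \<bullet> x"] cone(2)
    by (simp add: continuous_intros right_diff_distrib sum_subtractf sum_distrib_left mult.commute)
  define K where "K = (d + 1) * (d + 2)\<^sup>2"
  have expand: "(u + \<Sum>(C F)) \<bullet> (u + \<Sum>(C F)) + (u \<bullet> u + (\<Sum>u\<in>C F. u \<bullet> u))
      = g F + 2 * (u \<bullet> u + u \<bullet> \<Sum>(C F))" for u F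
    by (simp add: g_def inner_add_left inner_add_right inner_commute)
  have ineq: "\<sigma> * (g F + 2 * (u \<bullet> u + u \<bullet> \<Sum>(C F)) - K) \<le> 0" if F: "F \<in> ?FF" and u: "u \<in> C F" for F u
  proof -
    have "u \<in> F" using hull_inc[OF u, of convex] C(3)[OF F] by simp
    then have "\<sigma> * (g F + 2 * (u \<bullet> u + u \<bullet> \<Sum>(C F))) \<le> \<sigma> * K"
      using facet_first_order[OF P \<sigma> ext _ C(3)[OF F, symmetric] C(1)[OF F] C(2)[OF F], of u] F
      unfolding expand K_def d_def by (simp add: algebra_simps)
    then show ?thesis by (simp add: algebra_simps)
  qed
  \<comment> \<open>Summed over the d vertices, u \<bullet> u + u \<bullet> S gives
    \<open>g F\<close> again, so the total is (d + 2) g - d K, and K = (d + 1) (d + 2)^2 lets the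
    factor d + 2 split off.\<close>
  have sum_ineq: "(\<Sum>u\<in>C F. g F + 2 * (u \<bullet> u + u \<bullet> \<Sum>(C F)) - K) = (d + 2) * (g F - d * ((d + 1) * (d + 2)))"
    if F: "F \<in> ?FF" for F
    using C(2)[OF F]
    by (simp add: sum.distrib sum_subtractf sum_distrib_left[symmetric] inner_sum_left[symmetric] d_def[symmetric])
      (simp add: g_def K_def power2_eq_square algebra_simps)
  have le: "\<sigma> * (g F / ((d + 1) * (d + 2)) - d) \<le> 0" if F: "F \<in> ?FF" for F
  proof -
    have "(\<Sum>u\<in>C F. \<sigma> * (g F + 2 * (u \<bullet> u + u \<bullet> \<Sum>(C F)) - K)) \<le> 0"
      using ineq[OF F] by (intro sum_nonpos)
    then have "(d + 2) * (\<sigma> * (g F - d * ((d + 1) * (d + 2)))) \<le> 0"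
      unfolding sum_distrib_left[symmetric] sum_ineq[OF F] by (simp only: mult.left_commute)
    then have "\<sigma> * (g F - d * ((d + 1) * (d + 2))) \<le> 0" using d by (simp add: mult_le_0_iff)
    then have "\<sigma> * (g F - d * ((d + 1) * (d + 2))) / ((d + 1) * (d + 2)) \<le> 0"
      using d by (intro divide_nonpos_pos) auto
    moreover have "\<sigma> * (y - d * M) / M = \<sigma> * (y / M - d)" if "M \<noteq> 0" for y M
      using that by (simp add: field_simps)
    moreover have "(d + 1) * (d + 2) \<noteq> 0" using d by simp
    ultimately show ?thesis by metis
  qed
  \<comment> \<open>Up to the sign \<open>\<sigma>\<close>, all terms of the weighted sum
    \<open>total\<close> are nonpositive and the weights are positive, so each term
    vanishes.\<close>
  have gF: "g F = d * ((d + 1) * (d + 2))" if F: "F \<in> ?FF" for F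
  proof -
    let ?h = "\<lambda>F. - (measure lborel (?T F) * (\<sigma> * (g F / ((d + 1) * (d + 2)) - d)))"
    have "(\<Sum>F\<in>?FF. ?h F) = - (\<sigma> * (\<Sum>F\<in>?FF. measure lborel (?T F) * (g F / ((d + 1) * (d + 2)) - d)))"
      by (simp add: sum_negf sum_distrib_left mult.left_commute)
    then have "(\<Sum>F\<in>?FF. ?h F) = 0" unfolding total by simp
    moreover have "?h F \<ge> 0" if "F \<in> ?FF" for F
      using le[OF that] cone(1)[OF that] by (simp add: mult_le_0_iff)
    ultimately have "?h F = 0" using sum_nonneg_eq_0_iff[OF finite_facets, of ?h] F by blast
    then have "g F / ((d + 1) * (d + 2)) = d" using cone(1)[OF F] \<sigma> by auto
    moreover have "(d + 1) * (d + 2) \<noteq> 0" using d by simp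
    ultimately show ?thesis by (metis nonzero_divide_eq_eq)
  qed
  show ?thesis
    unfolding vertex_condition_def
  proof (intro allI impI)
    fix F assume "F facet_of P"
    then have F: "F \<in> ?FF" by simp
    have fC: "finite (C F)" by (rule aff_independent_finite[OF C(1)[OF F]])
    \<comment> \<open>Now the inequalities at the vertices of \<open>F\<close> sum to 0 and so are
      equalities; K - g = 2 (d + 1) (d + 2) leaves the stated constant.\<close>
    have eq: "u \<bullet> u + u \<bullet> \<Sum>(C F) = real (CARD('n) + 1) * real (CARD('n) + 2)" if u: "u \<in> C F" for u
    proof -
      let ?h = "\<lambda>u. - (\<sigma> * (g F + 2 * (u \<bullet> u + u \<bullet> \<Sum>(C F)) - K))"
      have "(\<Sum>u\<in>C F. ?h u) = - (\<sigma> * ((d + 2) * (g F - d * ((d + 1) * (d + 2)))))"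
        unfolding sum_negf sum_distrib_left[symmetric] sum_ineq[OF F] ..
      then have "(\<Sum>u\<in>C F. ?h u) = 0" by (simp add: gF[OF F])
      moreover have "?h u \<ge> 0" if "u \<in> C F" for u using ineq[OF F that] by simp
      ultimately have "?h u = 0" using sum_nonneg_eq_0_iff[OF fC, of ?h] u by blast
      then have "g F + 2 * (u \<bullet> u + u \<bullet> \<Sum>(C F)) = K" using \<sigma> by auto
      then have "2 * (u \<bullet> u + u \<bullet> \<Sum>(C F)) = 2 * ((d + 1) * (d + 2))"
        unfolding gF[OF F] K_def by (simp add: power2_eq_square algebra_simps)
      then show ?thesis by (simp add: d_def algebra_simps)
    qed
    then show "\<exists>C. \<not> affine_dependent C \<and> card C = DIM(real^'n) \<and> F = convex hull C \<and>
        (\<forall>u\<in>C. u \<bullet> u + u \<bullet> \<Sum>C = real (CARD('n) + 1) * real (CARD('n) + 2))"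
      using C(1,2,3)[OF F] by (intro exI[of _ "C F"]) simp
  qed
qed

theorem theorem1:
  fixes P :: "(real^'n) set"
  assumes "polytope P"
    and "aff_dim P = int CARD('n)"
    and "isotropic P"
    and "simplicial P"
    and "local_extremum isotropic_constant P"
  shows "(\<forall>F H. F face_of P \<and> aff_dim F = int CARD('n) - 2 \<and> H = affine hull (insert 0 F)
            \<longrightarrow> reflection_across H ` P = P)
         \<and> isohedral P
         \<and> (\<forall>F G. F facet_of P \<and> G facet_of P \<longrightarrow> congruent_sets F G)"
proof -
  have body: "convex_body P"
    using assms(5) by (auto simp: local_extremum_def local_maximum_def local_minimum_def)
  have P: "polytope_around_0 P"
    using assms(1,3) zero_in_interior_if_centered[OF body]
    by (simp add: polytope_around_0_def isotropic_def)
  obtain \<sigma> \<epsilon> :: real where "\<sigma> = 1 \<or> \<sigma> = -1" "\<epsilon> > 0"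
    "\<And>L. convex_body L \<Longrightarrow> hausdorff_dist P L < \<epsilon> \<Longrightarrow> \<sigma> * isotropic_constant L \<le> \<sigma> * isotropic_constant P"
  proof (cases "local_maximum isotropic_constant P")
    case True
    then show ?thesis using that[of 1] unfolding local_maximum_def by auto
  next
    case False
    then have "local_minimum isotropic_constant P" using assms(5) by (simp add: local_extremum_def)
    then show ?thesis using that[of "-1"] unfolding local_minimum_def by auto
  qed
  then have "vertex_condition (real (CARD('n) + 1) * real (CARD('n) + 2)) P"
    using vertex_condition_if_extremal[OF P assms(3) _ _ _ assms(4)] by blast
  then interpret critical_polytope P "real (CARD('n) + 1) * real (CARD('n) + 2)"
    using P by (simp add: critical_polytope_def critical_polytope_axioms_def)
  have "congruent_sets F G" if FG: "F facet_of P" "G facet_of P" for F G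
  proof -
    obtain g where "g \<in> symmetry_group P" "g ` F = G"
      using isohedral FG unfolding isohedral_def by blast
    then show ?thesis by (auto simp: congruent_sets_def symmetry_group_def)
  qed
  then show ?thesis using ridge_reflection_symmetric isohedral by simp
qed

end
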